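(* Consider the two-phase RSPG (2-RSPG) algorithm described in the context (with parameter $\tilde D>0$), under Assumption A1, with $\|\cdot\|$ the Euclidean norm. Let $D_\Psi:=[(\Psi(x_1)-\Psi^* )/L]^{1/2}$, let $g_X(x):=P_X(x,\nabla f(x),\alpha/(2L))$ for $x\in X$, and let $$\mathcal{B}_{\bar N}:=\frac{16LD_\Psi^2}{\bar N}+\frac{4\sqrt6\,\sigma}{\sqrt{\bar N}}\left(\frac{D_\Psi^2}{\tilde D}+\tilde D\max\left\{1,\frac{\sqrt6\,\sigma}{4L\tilde D\sqrt{\bar N}}\right\}\right).$$ Then the output $\bar x^*$ satisfies: (a) For all $\lambda>0$, $$\mathrm{Prob}\left\{\|g_X(\bar x^* )\|^2\ge\frac{2}{\alpha^2}\left(4L\mathcal{B}_{\bar N}+\frac{3\lambda\sigma^2}{T}\right)\right\}\le\frac{S}{\lambda}+2^{-S}.$$ (b) Let $\epsilon>0$ and $\Lambda\in(0,1)$. If $(S,\bar N,T)$ are set to $$S(\Lambda):=\lceil\log_2(2/\Lambda)\rceil,$$ $$\bar N(\epsilon):=\left\lceil\max\left\{\frac{512L^2D_\Psi^2}{\alpha^2\epsilon},\left[\left(\tilde D+\frac{D_\Psi^2}{\tilde D}\right)\frac{128\sqrt6\,L\sigma}{\alpha^2\epsilon}\right]^2,\frac{3\sigma^2}{8L^2\tilde D^2}\right\}\right\rceil,$$ $$T(\epsilon,\Lambda):=\left\lceil\frac{24S(\Lambda)\sigma^2}{\alpha^2\Lambda\epsilon}\right\rceil,$$ then the 2-RSPG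 algorithm computes an $(\epsilon,\Lambda)$-solution, i.e. $\mathrm{Prob}\{\|g_X(\bar x^* )\|^2\le\epsilon\}\ge1-\Lambda$, after taking at most $S(\Lambda)[\bar N(\epsilon)+T(\epsilon,\Lambda)]$ calls to the stochastic first-order oracle.
   Context: Setting. $\langle\cdot,\cdot\rangle$ and $\|\cdot\|$ are the standard Euclidean inner product and norm on $\mathbb{R}^n$. $X\subseteq\mathbb{R}^n$ is a nonempty closed convex set; $f:X\to\mathbb{R}$ is continuously differentiable (possibly nonconvex) with $\|\nabla f(y)-\nabla f(x)\|\le L\|y-x\|$ for all $x,y\in X$, where $L>0$; $h:X\to\mathbb{R}$ is convex (possibly nonsmooth); $\Psi:=f+h$ and $\Psi^*:=\inf_{x\in X}\Psi(x)$ is finite. Prox-function. $\omega:X\to\mathbb{R}$ is continuously differentiable and satisfies $\langle x-z,\nabla\omega(x)-\nabla\omega(z)\rangle\ge\alpha\|x-z\|^2$ for all $x,z\in X$, with $\alpha>0$. $V(x,z):=\omega(x)-[\omega(z)+\langle\nabla\omega(z),x-z\rangle]$. For $x\in X$, $g\in\mathbb{R}^n$, $\gamma>0$ let $x^+:=\arg\min_{u\in X}\{\langle g,u\rangle+\frac1\gamma V(u,x)+h(u)\}$ (always assumed solvable), and $P_X(x,g,\gamma):=\frac1\gamma(x-x^+)$. RSPG algorithm. Input: $x_1\in X$, iteration limit $N$, stepsizes $\gamma_k>0$, positive integer batch sizes $m_k$, probability mass function $P_R$ on $\{1,\dots,N\}$. Draw $R\sim P_R$, independently of all samples. For $k=1,\dots,R-1$: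 call the stochastic first-order oracle $m_k$ times to obtain $G(x_k,\xi_{k,i})$, $i=1,\dots,m_k$ ($G$ a Borel function), set $G_k=\frac1{m_k}\sum_{i=1}^{m_k}G(x_k,\xi_{k,i})$ and $x_{k+1}=\arg\min_{u\in X}\{\langle G_k,u\rangle+\frac1{\gamma_k}V(u,x_k)+h(u)\}$. Output $x_R$. 2-RSPG algorithm. Input: $x_1\in X$, number of runs $S\ge1$, number $\bar N\ge1$ of oracle calls allowed in each run, and post-optimization sample size $T\ge1$. Optimization phase: perform $S$ independent runs of the RSPG algorithm, each from $x_1$, with $m_k=m=\lceil\min\{\max\{1,\frac{\sigma\sqrt{6\bar N}}{4L\tilde D}\},\bar N\}\rceil$ for a fixed parameter $\tilde D>0$, $N=\lfloor\bar N/m\rfloor$, $\gamma_k=\alpha/(2L)$ and $P_R(k)=(\alpha\gamma_k-L\gamma_k^2)/\sum_{j=1}^N(\alpha\gamma_j-L\gamma_j^2)$; let $\bar x_1,\dots,\bar x_S$ be the outputs. Post-optimization phase: for each $s$ let $\bar G_T(\bar x_s)=\frac1T\sum_{k=1}^TG(\bar x_s,\xi_k)$ (formed from $T$ new oracle calls at $\bar x_s$) and $\bar g_X(\bar x_s):=P_X(\bar x_s,\bar G_T(\bar x_s),\alpha/(2L))$; output $\bar x^*\in\{\bar x_1,\dots,\bar x_S\}$ with $\|\bar g_X(\bar x^* )\|=\min_{s=1,\dots,S}\|\bar g_X(\bar x_s)\|$. Assumption A1 (with constant $\sigma>0$). Whenever the oracle is called at a point $x\in X$, it returns $G(x,\xi)$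 such that, conditionally on $x$ and all previously drawn samples (in the post-optimization phase: conditionally on the candidates and the earlier post-optimization samples at that candidate), $\mathbb{E}[G(x,\xi)]=\nabla f(x)$ and $\mathbb{E}[\|G(x,\xi)-\nabla f(x)\|^2]\le\sigma^2$. *)

theory Defs
  imports "HOL-Probability.Probability"
begin

section \<open>Composite problem and prox-mapping\<close>

text \<open>
  Only the values of \<open>f\<close> on \<open>X\<close> matter. If \<open>X\<close> is not full-dimensional the gradient is not
  determined by \<open>f\<close>; \<open>Df\<close> is then any continuous choice of it.
\<close>
definition C1_on :: "'a::euclidean_space set \<Rightarrow> ('a \<Rightarrow> real) \<Rightarrow> ('a \<Rightarrow> 'a) \<Rightarrow> bool" where
  "C1_on X f Df \<longleftrightarrow>
     (\<forall>x\<in>X. (f has_derivative (\<lambda>d. Df x \<bullet> d)) (at x within X)) \<and> continuous_on X Df"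

definition prox_dist ::
    "('a::euclidean_space \<Rightarrow> real) \<Rightarrow> ('a \<Rightarrow> 'a) \<Rightarrow> 'a \<Rightarrow> 'a \<Rightarrow> real" where
  "prox_dist \<omega> D\<omega> x z = \<omega> x - (\<omega> z + D\<omega> z \<bullet> (x - z))"

definition prox_objective ::
    "('a::euclidean_space \<Rightarrow> real) \<Rightarrow> ('a \<Rightarrow> real) \<Rightarrow> ('a \<Rightarrow> 'a) \<Rightarrow> 'a \<Rightarrow> 'a \<Rightarrow> real \<Rightarrow> 'a \<Rightarrow> real" where
  "prox_objective h \<omega> D\<omega> x g \<gamma> u = g \<bullet> u + (1 / \<gamma>) * prox_dist \<omega> D\<omega> u x + h u"

text \<open>Meaningful because solvability is a standing assumption in \<open>composite_prox\<close> below.\<close>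
definition prox_map ::
    "'a::euclidean_space set \<Rightarrow> ('a \<Rightarrow> real) \<Rightarrow> ('a \<Rightarrow> real) \<Rightarrow> ('a \<Rightarrow> 'a) \<Rightarrow> 'a \<Rightarrow> 'a \<Rightarrow> real \<Rightarrow> 'a" where
  "prox_map X h \<omega> D\<omega> x g \<gamma> = arg_min_on (prox_objective h \<omega> D\<omega> x g \<gamma>) X"

definition proj_grad ::
    "'a::euclidean_space set \<Rightarrow> ('a \<Rightarrow> real) \<Rightarrow> ('a \<Rightarrow> real) \<Rightarrow> ('a \<Rightarrow> 'a) \<Rightarrow> 'a \<Rightarrow> 'a \<Rightarrow> real \<Rightarrow> 'a" where
  "proj_grad X h \<omega> D\<omega> x g \<gamma> = (1 / \<gamma>) *\<^sub>R (x - prox_map X h \<omega> D\<omega> x g \<gamma>)"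

text \<open>The projected gradient at the exact gradient, with the stepsize used by the method.\<close>
definition exact_proj_grad ::
    "'a::euclidean_space set \<Rightarrow> ('a \<Rightarrow> 'a) \<Rightarrow> ('a \<Rightarrow> real) \<Rightarrow> real \<Rightarrow> ('a \<Rightarrow> real) \<Rightarrow> ('a \<Rightarrow> 'a)
     \<Rightarrow> real \<Rightarrow> 'a \<Rightarrow> 'a" where
  "exact_proj_grad X Df h L \<omega> D\<omega> \<alpha> x = proj_grad X h \<omega> D\<omega> x (Df x) (\<alpha> / (2 * L))"

definition D_Psi ::
    "'a::euclidean_space set \<Rightarrow> ('a \<Rightarrow> real) \<Rightarrow> ('a \<Rightarrow> real) \<Rightarrow> real \<Rightarrow> 'a \<Rightarrow> real" where
  "D_Psi X f h L x1 = sqrt (((f x1 + h x1) - (INF x\<in>X. f x + h x)) / L)"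

locale composite_prox =
  fixes X :: "'a::euclidean_space set"
    and f :: "'a \<Rightarrow> real" and Df :: "'a \<Rightarrow> 'a" and h :: "'a \<Rightarrow> real" and L :: real
    and \<omega> :: "'a \<Rightarrow> real" and D\<omega> :: "'a \<Rightarrow> 'a" and \<alpha> :: real
  assumes X_nonempty: "X \<noteq> {}" and X_closed: "closed X" and X_convex: "convex X"
    and f_C1: "C1_on X f Df"
    and L_pos: "L > 0"
    and Df_lipschitz: "\<And>x y. x \<in> X \<Longrightarrow> y \<in> X \<Longrightarrow> norm (Df y - Df x) \<le> L * norm (y - x)"
    and h_convex: "convex_on X h"
    and Psi_bounded: "bdd_below ((\<lambda>x. f x + h x) ` X)"
    and \<alpha>_pos: "\<alpha> > 0"
    and \<omega>_C1: "C1_on X \<omega> D\<omega>"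
    and \<omega>_strong:
      "\<And>x z. x \<in> X \<Longrightarrow> z \<in> X \<Longrightarrow> (x - z) \<bullet> (D\<omega> x - D\<omega> z) \<ge> \<alpha> * (norm (x - z))\<^sup>2"
    and prox_solvable:
      "\<And>x g \<gamma>. x \<in> X \<Longrightarrow> \<gamma> > 0 \<Longrightarrow>
         \<exists>u. is_arg_min (prox_objective h \<omega> D\<omega> x g \<gamma>) (\<lambda>u. u \<in> X) u"


section \<open>The RSPG algorithm\<close>

definition sample_avg ::
    "('a::euclidean_space \<Rightarrow> 'b \<Rightarrow> 'a) \<Rightarrow> 'a \<Rightarrow> (nat \<Rightarrow> 'b) \<Rightarrow> nat \<Rightarrow> 'a" where
  "sample_avg G x z m = (1 / real m) *\<^sub>R (\<Sum>i=1..m. G x (z i))"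

text \<open>
  Iterates along a realization \<open>z k i\<close> of the samples (iteration \<open>k\<close>, call \<open>i\<close>). They are
  numbered from 1; the value at 0 is a dummy.
\<close>
primrec rspg_iter ::
    "'a::euclidean_space set \<Rightarrow> ('a \<Rightarrow> real) \<Rightarrow> ('a \<Rightarrow> real) \<Rightarrow> ('a \<Rightarrow> 'a) \<Rightarrow> ('a \<Rightarrow> 'b \<Rightarrow> 'a)
     \<Rightarrow> (nat \<Rightarrow> nat) \<Rightarrow> (nat \<Rightarrow> real) \<Rightarrow> 'a \<Rightarrow> (nat \<Rightarrow> nat \<Rightarrow> 'b) \<Rightarrow> nat \<Rightarrow> 'a" where
  "rspg_iter X h \<omega> D\<omega> G m \<gamma> x1 z 0 = x1"
| "rspg_iter X h \<omega> D\<omega> G m \<gamma> x1 z (Suc k) =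
     (if k = 0 then x1
      else let x = rspg_iter X h \<omega> D\<omega> G m \<gamma> x1 z k
           in prox_map X h \<omega> D\<omega> x (sample_avg G x (z k) (m k)) (\<gamma> k))"

definition rspg_weight :: "real \<Rightarrow> real \<Rightarrow> (nat \<Rightarrow> real) \<Rightarrow> nat \<Rightarrow> nat \<Rightarrow> real" where
  "rspg_weight \<alpha> L \<gamma> N k =
     (\<alpha> * \<gamma> k - L * (\<gamma> k)\<^sup>2) / (\<Sum>j=1..N. \<alpha> * \<gamma> j - L * (\<gamma> j)\<^sup>2)"

text \<open>Oracle calls of a run that stops at iteration \<open>r\<close>: only iterations \<open>1, \<dots>, r - 1\<close> sample.\<close>
definition rspg_calls :: "(nat \<Rightarrow> nat) \<Rightarrow> nat \<Rightarrow> nat" where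
  "rspg_calls m r = (\<Sum>k=1..<r. m k)"


section \<open>The stochastic first-order oracle\<close>

text \<open>
  The conditional mean is taken componentwise. The second moment uses the conditional expectation
  of nonnegative functions, so its finiteness is part of the condition.
\<close>
definition oracle_reply ::
    "'w measure \<Rightarrow> 'w measure \<Rightarrow> ('a::euclidean_space \<Rightarrow> 'a) \<Rightarrow> real
     \<Rightarrow> ('w \<Rightarrow> 'a) \<Rightarrow> ('w \<Rightarrow> 'a) \<Rightarrow> bool" where
  "oracle_reply M F Df \<sigma> x Y \<longleftrightarrow>
     integrable M Y \<and>
     (\<forall>b\<in>Basis. AE w in M. real_cond_exp M F (\<lambda>w. Y w \<bullet> b) w = Df (x w) \<bullet> b) \<and>
     (AE w in M. nn_cond_exp M F (\<lambda>w. ennreal ((norm (Y w - Df (x w)))\<^sup>2)) w \<le> ennreal (\<sigma>\<^sup>2))"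

definition previous_calls :: "(nat \<Rightarrow> nat) \<Rightarrow> nat \<Rightarrow> nat \<Rightarrow> (nat \<times> nat) set" where
  "previous_calls m k i = (SIGMA j:{1..<k}. {1..m j}) \<union> {k} \<times> {1..<i}"

text \<open>
  The information before call \<open>i\<close> of iteration \<open>k\<close>: the sigma-algebra generated by the current
  iterate \<open>x\<close> and the samples drawn so far in the same run. Other runs are independent, so
  including their samples would not change the conditional moments.
\<close>
definition run_history ::
    "'w measure \<Rightarrow> 'b measure \<Rightarrow> (nat \<Rightarrow> nat) \<Rightarrow> ('w \<Rightarrow> 'a::euclidean_space)
     \<Rightarrow> (nat \<Rightarrow> nat \<Rightarrow> 'w \<Rightarrow> 'b) \<Rightarrow> nat \<Rightarrow> nat \<Rightarrow> 'w measure" where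
  "run_history M \<Xi> m x \<xi> k i =
     vimage_algebra (space M)
       (\<lambda>w. (x w, \<lambda>j\<in>previous_calls m k i. \<xi> (fst j) (snd j) w))
       (borel \<Otimes>\<^sub>M PiM (previous_calls m k i) (\<lambda>_. \<Xi>))"

definition post_history ::
    "'w measure \<Rightarrow> 'b measure \<Rightarrow> nat \<Rightarrow> (nat \<Rightarrow> 'w \<Rightarrow> 'a::euclidean_space)
     \<Rightarrow> (nat \<Rightarrow> 'w \<Rightarrow> 'b) \<Rightarrow> nat \<Rightarrow> 'w measure" where
  "post_history M \<Xi> S xbar \<zeta> k =
     vimage_algebra (space M)
       (\<lambda>w. (\<lambda>s\<in>{1..S}. xbar s w, \<lambda>j\<in>{1..<k}. \<zeta> j w))
       (PiM {1..S} (\<lambda>_. borel) \<Otimes>\<^sub>M PiM {1..<k} (\<lambda>_. \<Xi>))"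


section \<open>The 2-RSPG algorithm\<close>

definition batch_size :: "real \<Rightarrow> real \<Rightarrow> real \<Rightarrow> nat \<Rightarrow> nat" where
  "batch_size L \<sigma> Dt Nbar =
     nat \<lceil>min (max 1 (\<sigma> * sqrt (6 * real Nbar) / (4 * L * Dt))) (real Nbar)\<rceil>"

definition iteration_limit :: "real \<Rightarrow> real \<Rightarrow> real \<Rightarrow> nat \<Rightarrow> nat" where
  "iteration_limit L \<sigma> Dt Nbar = nat \<lfloor>real Nbar / real (batch_size L \<sigma> Dt Nbar)\<rfloor>"

definition run_iter ::
    "'a::euclidean_space set \<Rightarrow> ('a \<Rightarrow> real) \<Rightarrow> ('a \<Rightarrow> real) \<Rightarrow> ('a \<Rightarrow> 'a) \<Rightarrow> real \<Rightarrow> real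
     \<Rightarrow> ('a \<Rightarrow> 'b \<Rightarrow> 'a) \<Rightarrow> real \<Rightarrow> real \<Rightarrow> nat \<Rightarrow> 'a
     \<Rightarrow> (nat \<Rightarrow> nat \<Rightarrow> nat \<Rightarrow> 'w \<Rightarrow> 'b) \<Rightarrow> nat \<Rightarrow> nat \<Rightarrow> 'w \<Rightarrow> 'a" where
  "run_iter X h \<omega> D\<omega> \<alpha> L G \<sigma> Dt Nbar x1 \<xi> s k w =
     rspg_iter X h \<omega> D\<omega> G (\<lambda>_. batch_size L \<sigma> Dt Nbar) (\<lambda>_. \<alpha> / (2 * L)) x1
       (\<lambda>k i. \<xi> s k i w) k"

definition run_output ::
    "'a::euclidean_space set \<Rightarrow> ('a \<Rightarrow> real) \<Rightarrow> ('a \<Rightarrow> real) \<Rightarrow> ('a \<Rightarrow> 'a) \<Rightarrow> real \<Rightarrow> real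
     \<Rightarrow> ('a \<Rightarrow> 'b \<Rightarrow> 'a) \<Rightarrow> real \<Rightarrow> real \<Rightarrow> nat \<Rightarrow> 'a
     \<Rightarrow> (nat \<Rightarrow> nat \<Rightarrow> nat \<Rightarrow> 'w \<Rightarrow> 'b) \<Rightarrow> (nat \<Rightarrow> 'w \<Rightarrow> nat) \<Rightarrow> nat \<Rightarrow> 'w \<Rightarrow> 'a" where
  "run_output X h \<omega> D\<omega> \<alpha> L G \<sigma> Dt Nbar x1 \<xi> R s w =
     run_iter X h \<omega> D\<omega> \<alpha> L G \<sigma> Dt Nbar x1 \<xi> s (R s w) w"

definition post_grad ::
    "'a::euclidean_space set \<Rightarrow> ('a \<Rightarrow> real) \<Rightarrow> ('a \<Rightarrow> real) \<Rightarrow> ('a \<Rightarrow> 'a) \<Rightarrow> real \<Rightarrow> real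
     \<Rightarrow> ('a \<Rightarrow> 'b \<Rightarrow> 'a) \<Rightarrow> nat \<Rightarrow> (nat \<Rightarrow> 'w \<Rightarrow> 'a) \<Rightarrow> (nat \<Rightarrow> nat \<Rightarrow> 'w \<Rightarrow> 'b) \<Rightarrow> nat \<Rightarrow> 'w \<Rightarrow> 'a" where
  "post_grad X h \<omega> D\<omega> \<alpha> L G T xbar \<zeta> s w =
     proj_grad X h \<omega> D\<omega> (xbar s w) (sample_avg G (xbar s w) (\<lambda>k. \<zeta> s k w) T) (\<alpha> / (2 * L))"

definition two_rspg_calls :: "nat \<Rightarrow> nat \<Rightarrow> nat \<Rightarrow> (nat \<Rightarrow> 'w \<Rightarrow> nat) \<Rightarrow> 'w \<Rightarrow> nat" where
  "two_rspg_calls m S T R w = (\<Sum>s=1..S. rspg_calls (\<lambda>_. m) (R s w)) + (\<Sum>s=1..S. T)"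

text \<open>
  An execution of the method on the probability space \<open>M\<close>. \<open>\<xi> s k i\<close> is the sample of call \<open>i\<close> in
  iteration \<open>k\<close> of run \<open>s\<close>, \<open>R s\<close> the stopping index of run \<open>s\<close>, and \<open>\<zeta> s k\<close> the \<open>k\<close>-th
  post-optimization sample at candidate \<open>s\<close>. The samples of a run are given for every iteration
  below the limit \<open>N\<close>, which is what makes the independence of \<open>R s\<close> from them meaningful; the
  output uses only those of iterations below \<open>R s\<close>. The returned candidate is given by its index
  \<open>sel\<close>, because equal candidates may have different post-optimization estimates; ties are broken
  in any measurable way.
\<close>
locale two_rspg = composite_prox X f Df h L \<omega> D\<omega> \<alpha> + prob_space M
  for X :: "'a::euclidean_space set" and f Df h L \<omega> D\<omega> \<alpha> and M :: "'w measure" +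
  fixes \<Xi> :: "'b measure" and G :: "'a \<Rightarrow> 'b \<Rightarrow> 'a" and \<sigma> Dt :: real
    and S Nbar T :: nat and x1 :: 'a
    and \<xi> :: "nat \<Rightarrow> nat \<Rightarrow> nat \<Rightarrow> 'w \<Rightarrow> 'b" and R :: "nat \<Rightarrow> 'w \<Rightarrow> nat"
    and \<zeta> :: "nat \<Rightarrow> nat \<Rightarrow> 'w \<Rightarrow> 'b" and sel :: "'w \<Rightarrow> nat"
    and m N :: nat and x :: "nat \<Rightarrow> nat \<Rightarrow> 'w \<Rightarrow> 'a" and xbar gbar :: "nat \<Rightarrow> 'w \<Rightarrow> 'a"
  defines "m \<equiv> batch_size L \<sigma> Dt Nbar"
    and "N \<equiv> iteration_limit L \<sigma> Dt Nbar"
    and "x \<equiv> run_iter X h \<omega> D\<omega> \<alpha> L G \<sigma> Dt Nbar x1 \<xi>"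
    and "xbar \<equiv> run_output X h \<omega> D\<omega> \<alpha> L G \<sigma> Dt Nbar x1 \<xi> R"
    and "gbar \<equiv> post_grad X h \<omega> D\<omega> \<alpha> L G T xbar \<zeta>"
  assumes \<sigma>_pos: "\<sigma> > 0" and Dt_pos: "Dt > 0"
    and S_pos: "S \<ge> 1" and Nbar_pos: "Nbar \<ge> 1" and T_pos: "T \<ge> 1"
    and x1_in: "x1 \<in> X"
    and G_measurable: "(\<lambda>(x, z). G x z) \<in> borel_measurable (restrict_space borel X \<Otimes>\<^sub>M \<Xi>)"
    and \<xi>_measurable: "\<And>s k i. s \<in> {1..S} \<Longrightarrow> k \<in> {1..<N} \<Longrightarrow> i \<in> {1..m} \<Longrightarrow> \<xi> s k i \<in> M \<rightarrow>\<^sub>M \<Xi>"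
    and \<zeta>_measurable: "\<And>s k. s \<in> {1..S} \<Longrightarrow> k \<in> {1..T} \<Longrightarrow> \<zeta> s k \<in> M \<rightarrow>\<^sub>M \<Xi>"
    and R_measurable: "\<And>s. s \<in> {1..S} \<Longrightarrow> R s \<in> M \<rightarrow>\<^sub>M count_space {1..N}"
    and R_distribution:
      "\<And>s k. s \<in> {1..S} \<Longrightarrow> k \<in> {1..N} \<Longrightarrow>
         \<P>(w in M. R s w = k) = rspg_weight \<alpha> L (\<lambda>_. \<alpha> / (2 * L)) N k"
    and R_indep_samples:
      "\<And>s. s \<in> {1..S} \<Longrightarrow>
         indep_set
           (sets (vimage_algebra (space M) (R s) (count_space {1..N})))
           (sets (vimage_algebra (space M)
             (\<lambda>w. \<lambda>j\<in>{1..<N} \<times> {1..m}. \<xi> s (fst j) (snd j) w)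
             (PiM ({1..<N} \<times> {1..m}) (\<lambda>_. \<Xi>))))"
    and runs_indep:
      "indep_vars (\<lambda>_. count_space {1..N} \<Otimes>\<^sub>M PiM ({1..<N} \<times> {1..m}) (\<lambda>_. \<Xi>))
         (\<lambda>s w. (R s w, \<lambda>j\<in>{1..<N} \<times> {1..m}. \<xi> s (fst j) (snd j) w)) {1..S}"
    and oracle_run:
      "\<And>s k i. s \<in> {1..S} \<Longrightarrow> k \<in> {1..<N} \<Longrightarrow> i \<in> {1..m} \<Longrightarrow>
         oracle_reply M (run_history M \<Xi> (\<lambda>_. m) (x s k) (\<xi> s) k i) Df \<sigma> (x s k)
           (\<lambda>w. G (x s k w) (\<xi> s k i w))"
    and oracle_post:
      "\<And>s k. s \<in> {1..S} \<Longrightarrow> k \<in> {1..T} \<Longrightarrow>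
         oracle_reply M (post_history M \<Xi> S xbar (\<zeta> s) k) Df \<sigma> (xbar s)
           (\<lambda>w. G (xbar s w) (\<zeta> s k w))"
    and sel_measurable: "sel \<in> M \<rightarrow>\<^sub>M count_space {1..S}"
    and sel_min:
      "\<And>w. w \<in> space M \<Longrightarrow> norm (gbar (sel w) w) = (MIN s\<in>{1..S}. norm (gbar s w))"

definition two_rspg_output ::
    "'a::euclidean_space set \<Rightarrow> ('a \<Rightarrow> real) \<Rightarrow> ('a \<Rightarrow> real) \<Rightarrow> ('a \<Rightarrow> 'a) \<Rightarrow> real \<Rightarrow> real
     \<Rightarrow> ('a \<Rightarrow> 'b \<Rightarrow> 'a) \<Rightarrow> real \<Rightarrow> real \<Rightarrow> nat \<Rightarrow> 'a
     \<Rightarrow> (nat \<Rightarrow> nat \<Rightarrow> nat \<Rightarrow> 'w \<Rightarrow> 'b) \<Rightarrow> (nat \<Rightarrow> 'w \<Rightarrow> nat) \<Rightarrow> ('w \<Rightarrow> nat) \<Rightarrow> 'w \<Rightarrow> 'a" where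
  "two_rspg_output X h \<omega> D\<omega> \<alpha> L G \<sigma> Dt Nbar x1 \<xi> R sel w =
     run_output X h \<omega> D\<omega> \<alpha> L G \<sigma> Dt Nbar x1 \<xi> R (sel w) w"


section \<open>Complexity bounds\<close>

definition B_bound :: "real \<Rightarrow> real \<Rightarrow> real \<Rightarrow> real \<Rightarrow> nat \<Rightarrow> real" where
  "B_bound L \<sigma> DPsi Dt Nbar =
     16 * L * DPsi\<^sup>2 / real Nbar
     + 4 * sqrt 6 * \<sigma> / sqrt (real Nbar)
       * (DPsi\<^sup>2 / Dt + Dt * max 1 (sqrt 6 * \<sigma> / (4 * L * Dt * sqrt (real Nbar))))"

definition S_choice :: "real \<Rightarrow> nat" where
  "S_choice \<Lambda> = nat \<lceil>log 2 (2 / \<Lambda>)\<rceil>"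

definition Nbar_choice :: "real \<Rightarrow> real \<Rightarrow> real \<Rightarrow> real \<Rightarrow> real \<Rightarrow> real \<Rightarrow> nat" where
  "Nbar_choice \<alpha> L \<sigma> DPsi Dt \<epsilon> =
     nat \<lceil>Max {512 * L\<^sup>2 * DPsi\<^sup>2 / (\<alpha>\<^sup>2 * \<epsilon>),
               ((Dt + DPsi\<^sup>2 / Dt) * (128 * sqrt 6 * L * \<sigma> / (\<alpha>\<^sup>2 * \<epsilon>)))\<^sup>2,
               3 * \<sigma>\<^sup>2 / (8 * L\<^sup>2 * Dt\<^sup>2)}\<rceil>"

definition T_choice :: "real \<Rightarrow> real \<Rightarrow> real \<Rightarrow> real \<Rightarrow> nat" where
  "T_choice \<alpha> \<sigma> \<epsilon> \<Lambda> = nat \<lceil>24 * real (S_choice \<Lambda>) * \<sigma>\<^sup>2 / (\<alpha>\<^sup>2 * \<Lambda> * \<epsilon>)\<rceil>"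

end

theory Submission
  imports Defs
begin

text \<open>
  One prox step with the stochastic gradient decreases \<open>\<Psi>\<close> by a multiple of the squared norm of the
  stochastic projected gradient, up to the squared noise and an inner product of the noise with the
  exact projected gradient, which has mean zero. The batch noise has second moment at most
  \<open>\<sigma>\<^sup>2 / m\<close>, because noise in different calls is uncorrelated. Telescoping bounds the average over
  \<open>k \<le> N\<close> of the second moments of the exact projected gradients by \<open>L * B / \<alpha>\<^sup>2\<close>; the last iterate has
  no sample batch, so its term comes from an exact prox step instead. By Markov's inequality a run
  fails with probability at most 1/2, and by independence all \<open>S\<close> runs fail with probability at most
  \<open>2\<^sup>-\<^sup>S\<close>. The projected gradient is \<open>1 / \<alpha>\<close>-Lipschitz in the gradient, so Markov's inequality also
  controls each post-optimization estimate, and a union bound over the candidates gives \<open>S / \<lambda>\<close>.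
\<close>

section \<open>Projected gradients and one-step descent\<close>

text \<open>The stochastic projected gradient depends on the noise of its own step, so its inner
  product with that noise need not have mean zero; the Lipschitz bound trades it for the exact
  projected gradient at the price of squared noise. Square integrability of the exact projected
  gradients is not assumed. It comes from their bound by \<open>\<Psi> x - \<Psi>_star\<close>,
  within the same induction as the descent, because the cross term at step \<open>k\<close> can only
  be discarded once it is known. The constant stepsize makes all weights of \<open>R\<close> equal.
  The iterates are functions of the samples alone, whatever the value of \<open>R\<close>, so for
  fixed \<open>k\<close> the event that \<open>R\<close> equals \<open>k\<close> is independent of
  iterate \<open>k\<close>. The batch size balances the descent term, proportional to m / Nbar,
  against the noise term, proportional to 1 / m, with \<open>Dt\<close> in the place of
  \<open>D_Psi\<close>. The returned index depends on the post-optimization samples, so the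
  deviation at that index can only be controlled together with those of all candidates; hence the
  factor \<open>S\<close> in front of 1 / lambda.\<close>

lemma C1_on_segment_derivative:
  assumes "C1_on X f Df" "convex X" "p \<in> X" "u \<in> X" "t \<in> {0..1}"
  shows "((\<lambda>t. f (p + t *\<^sub>R (u - p))) has_real_derivative Df (p + t *\<^sub>R (u - p)) \<bullet> (u - p))
    (at t within {0..1})"
proof -
  have seg: "p + r *\<^sub>R (u - p) \<in> X" if "r \<in> {0..1}" for r :: real
  proof -
    have "(1 - r) *\<^sub>R p + r *\<^sub>R u \<in> X"
      using assms that by (intro convexD) auto
    then show ?thesis by (simp add: algebra_simps)
  qed
  define \<phi> where "\<phi> = (\<lambda>t::real. p + t *\<^sub>R (u - p))"
  have im: "\<phi> ` {0..1} \<subseteq> X" using seg by (auto simp: \<phi>_def)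
  have "(f has_derivative (\<lambda>d. Df (\<phi> t) \<bullet> d)) (at (\<phi> t) within X)"
    using assms seg[OF assms(5)] by (auto simp: C1_on_def \<phi>_def)
  then have "(f has_derivative (\<lambda>d. Df (\<phi> t) \<bullet> d)) (at (\<phi> t) within \<phi> ` {0..1})"
    using im by (rule has_derivative_subset)
  moreover have "(\<phi> has_derivative (\<lambda>r. r *\<^sub>R (u - p))) (at t within {0..1})"
    unfolding \<phi>_def by (auto intro!: derivative_eq_intros)
  ultimately have "(f \<circ> \<phi> has_derivative (\<lambda>d. Df (\<phi> t) \<bullet> d) \<circ> (\<lambda>r. r *\<^sub>R (u - p))) (at t within {0..1})"
    by (intro diff_chain_within)
  moreover have "(\<lambda>d. Df (\<phi> t) \<bullet> d) \<circ> (\<lambda>r. r *\<^sub>R (u - p)) = (*) (Df (\<phi> t) \<bullet> (u - p))"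
    by (auto simp: fun_eq_iff)
  ultimately show ?thesis
    by (simp add: has_field_derivative_def o_def \<phi>_def)
qed

text \<open>Subtracting the linear term and the quadratic from \<open>f\<close> along the segment
  leaves a function \<open>\<phi>\<close> whose derivative is nonpositive by Cauchy-Schwarz and the
  Lipschitz condition. The mean value theorem then gives the constant L / 2 without integrating the
  gradient.\<close>

lemma lipschitz_gradient_descent:
  assumes C1: "C1_on X f Df" and "convex X" and xy: "x \<in> X" "y \<in> X"
    and lip: "\<And>u v. u \<in> X \<Longrightarrow> v \<in> X \<Longrightarrow> norm (Df v - Df u) \<le> L * norm (v - u)"
  shows "f y \<le> f x + Df x \<bullet> (y - x) + L / 2 * (norm (y - x))\<^sup>2"
proof -
  define d where "d = y - x"
  define \<phi> where "\<phi> t = f (x + t *\<^sub>R d) - t * (Df x \<bullet> d) - L / 2 * t\<^sup>2 * (norm d)\<^sup>2" for t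
  have der: "(\<phi> has_derivative (*) (Df (x + t *\<^sub>R d) \<bullet> d - Df x \<bullet> d - L * t * (norm d)\<^sup>2))
      (at t within {0..1})" if "t \<in> {0..1}" for t
    using C1_on_segment_derivative[OF C1 \<open>convex X\<close> xy that]
    unfolding \<phi>_def d_def has_field_derivative_def[symmetric]
    by (auto intro!: derivative_eq_intros)
  obtain t where t: "t \<in> {0<..<1}"
    and eq: "\<phi> 1 - \<phi> 0 = (Df (x + t *\<^sub>R d) \<bullet> d - Df x \<bullet> d - L * t * (norm d)\<^sup>2) * (1 - 0)"
    using mvt_simple[of 0 1 \<phi>, OF _ der] by auto
  have "(1 - t) *\<^sub>R x + t *\<^sub>R y \<in> X"
    using assms t by (intro convexD) auto
  then have mem: "x + t *\<^sub>R d \<in> X" by (simp add: d_def algebra_simps)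
  have "(Df (x + t *\<^sub>R d) - Df x) \<bullet> d \<le> norm (Df (x + t *\<^sub>R d) - Df x) * norm d"
    by (rule norm_cauchy_schwarz)
  also have "\<dots> \<le> (L * norm (x + t *\<^sub>R d - x)) * norm d"
    using lip[OF xy(1) mem] by (intro mult_right_mono) auto
  also have "\<dots> = L * t * (norm d)\<^sup>2" using t by (simp add: power2_eq_square)
  finally have "\<phi> 1 \<le> \<phi> 0" using eq by (simp add: inner_diff_left)
  then show ?thesis by (simp add: \<phi>_def d_def)
qed

context composite_prox
begin

section \<open>Optimality and stability of the prox-mapping\<close>

lemma prox_map_is_arg_min:
  assumes "x \<in> X" "\<gamma> > 0"
  shows "is_arg_min (prox_objective h \<omega> D\<omega> x g \<gamma>) (\<lambda>u. u \<in> X) (prox_map X h \<omega> D\<omega> x g \<gamma>)"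
  using prox_solvable[OF assms] unfolding prox_map_def arg_min_on_def arg_min_def
  by (rule someI_ex)

lemma prox_map_in: "x \<in> X \<Longrightarrow> \<gamma> > 0 \<Longrightarrow> prox_map X h \<omega> D\<omega> x g \<gamma> \<in> X"
  using prox_map_is_arg_min[of x \<gamma> g] by (simp add: is_arg_min_def)

lemma prox_map_le:
  "x \<in> X \<Longrightarrow> \<gamma> > 0 \<Longrightarrow> u \<in> X \<Longrightarrow>
    prox_objective h \<omega> D\<omega> x g \<gamma> (prox_map X h \<omega> D\<omega> x g \<gamma>) \<le> prox_objective h \<omega> D\<omega> x g \<gamma> u"
  using prox_map_is_arg_min[of x \<gamma> g] by (simp add: is_arg_min_linorder)

text \<open>The minimizer \<open>p\<close> is compared with points at distance proportional to
  \<open>t\<close> on the segment towards \<open>u\<close>; the difference of objectives is divided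
  by \<open>t\<close> and \<open>t\<close> tends to 0. Only \<open>\<omega>\<close> is
  differentiated: convexity bounds the increment of \<open>h\<close> by
  \<open>t * (h u - h p)\<close>, so no subgradient of the nonsmooth part appears.\<close>

lemma prox_map_optimality:
  fixes g :: 'a
  assumes x: "x \<in> X" and \<gamma>: "\<gamma> > 0" and u: "u \<in> X"
  defines "p \<equiv> prox_map X h \<omega> D\<omega> x g \<gamma>"
  shows "0 \<le> (g + (1 / \<gamma>) *\<^sub>R (D\<omega> p - D\<omega> x)) \<bullet> (u - p) + h u - h p"
proof -
  have p: "p \<in> X" unfolding p_def using x \<gamma> by (rule prox_map_in)
  define q where "q t = (\<omega> (p + t *\<^sub>R (u - p)) - \<omega> p) / t" for t
  have "((\<lambda>t. \<omega> (p + t *\<^sub>R (u - p))) has_real_derivative D\<omega> p \<bullet> (u - p)) (at 0 within {0..1})"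
    using C1_on_segment_derivative[OF \<omega>_C1 X_convex p u, of 0] by simp
  then have "(q \<longlongrightarrow> D\<omega> p \<bullet> (u - p)) (at 0 within {0..1})"
    unfolding has_field_derivative_iff q_def by simp
  then have lim: "((\<lambda>t. g \<bullet> (u - p) + (1 / \<gamma>) * (q t - D\<omega> x \<bullet> (u - p)) + h u - h p) \<longlongrightarrow>
      g \<bullet> (u - p) + (1 / \<gamma>) * (D\<omega> p \<bullet> (u - p) - D\<omega> x \<bullet> (u - p)) + h u - h p) (at 0 within {0..1})"
    by (intro tendsto_intros)
  have "0 \<le> g \<bullet> (u - p) + (1 / \<gamma>) * (q t - D\<omega> x \<bullet> (u - p)) + h u - h p"
    if t: "t \<in> {0<..1}" for t
  proof -
    define y where "y = p + t *\<^sub>R (u - p)"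
    have y: "y = (1 - t) *\<^sub>R p + t *\<^sub>R u" by (simp add: y_def algebra_simps)
    have "y \<in> X" unfolding y using t p u X_convex by (intro convexD) auto
    from prox_map_le[OF x \<gamma> this, of g]
    have 1: "0 \<le> g \<bullet> (y - p) + (1 / \<gamma>) * (\<omega> y - \<omega> p - D\<omega> x \<bullet> (y - p)) + h y - h p"
      by (simp add: p_def[symmetric] prox_objective_def prox_dist_def algebra_simps inner_diff_right)
    have 2: "h y \<le> (1 - t) * h p + t * h u"
      unfolding y using t p u by (intro convex_onD[OF h_convex]) auto
    have "0 \<le> t * (g \<bullet> (u - p) + (1 / \<gamma>) * (q t - D\<omega> x \<bullet> (u - p)) + h u - h p)"
    proof -
      have "t * (g \<bullet> (u - p) + (1 / \<gamma>) * (q t - D\<omega> x \<bullet> (u - p)) + h u - h p)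
        = t * (g \<bullet> (u - p)) + (1 / \<gamma>) * (t * q t - t * (D\<omega> x \<bullet> (u - p))) + t * (h u - h p)"
        by (simp add: algebra_simps)
      also have "\<dots> = g \<bullet> (y - p) + (1 / \<gamma>) * (\<omega> y - \<omega> p - D\<omega> x \<bullet> (y - p)) + t * (h u - h p)"
        using t by (simp add: q_def y_def)
      finally have "t * (g \<bullet> (u - p) + (1 / \<gamma>) * (q t - D\<omega> x \<bullet> (u - p)) + h u - h p)
        = g \<bullet> (y - p) + (1 / \<gamma>) * (\<omega> y - \<omega> p - D\<omega> x \<bullet> (y - p)) + t * (h u - h p)" .
      then show ?thesis using 1 2 by (simp add: algebra_simps)
    qed
    then show ?thesis using t by (simp add: zero_le_mult_iff)
  qed
  \<comment> \<open>The filter at 0 within \<open>{0..1}\<close> leaves out \<open>t = 0\<close>, so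
    the inequality on \<open>{0<..1}\<close> is enough.\<close>
  then have "eventually (\<lambda>t. 0 \<le> g \<bullet> (u - p) + (1 / \<gamma>) * (q t - D\<omega> x \<bullet> (u - p)) + h u - h p)
      (at 0 within {0..1})"
    by (auto simp: eventually_at_filter)
  then have "0 \<le> g \<bullet> (u - p) + (1 / \<gamma>) * (D\<omega> p \<bullet> (u - p) - D\<omega> x \<bullet> (u - p)) + h u - h p"
    by (intro tendsto_lowerbound[OF lim]) (auto simp: at_within_Icc_at_right)
  then show ?thesis by (simp add: inner_add_left inner_diff_left)
qed

text \<open>Each optimality condition is tested at the other minimizer; on adding them the values of
  \<open>h\<close> cancel and strong monotonicity of \<open>D\<omega>\<close> remains. Two base
  points are allowed: equal ones give the Lipschitz bound in the gradient, different ones give joint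
  continuity and hence measurability.\<close>

lemma prox_map_lipschitz:
  assumes x: "x \<in> X" "y \<in> X" and \<gamma>: "\<gamma> > 0"
  shows "\<alpha> * norm (prox_map X h \<omega> D\<omega> x g \<gamma> - prox_map X h \<omega> D\<omega> y g' \<gamma>)
    \<le> norm (\<gamma> *\<^sub>R (g - g') + (D\<omega> y - D\<omega> x))"
proof -
  define p q where pq: "p = prox_map X h \<omega> D\<omega> x g \<gamma>" "q = prox_map X h \<omega> D\<omega> y g' \<gamma>"
  have X: "p \<in> X" "q \<in> X" using assms by (auto simp: pq prox_map_in)
  have "0 \<le> (g + (1 / \<gamma>) *\<^sub>R (D\<omega> p - D\<omega> x)) \<bullet> (q - p) + (g' + (1 / \<gamma>) *\<^sub>R (D\<omega> q - D\<omega> y)) \<bullet> (p - q)"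
    using prox_map_optimality[OF x(1) \<gamma> X(2), of g] prox_map_optimality[OF x(2) \<gamma> X(1), of g']
    by (simp add: pq)
  also have "\<dots> = (1 / \<gamma>) * ((\<gamma> *\<^sub>R (g - g') + (D\<omega> y - D\<omega> x)) \<bullet> (q - p) - (p - q) \<bullet> (D\<omega> p - D\<omega> q))"
    using \<gamma> by (simp add: inner_add_left inner_diff_left inner_diff_right inner_add_right field_simps inner_commute)
  finally have "(p - q) \<bullet> (D\<omega> p - D\<omega> q) \<le> (\<gamma> *\<^sub>R (g - g') + (D\<omega> y - D\<omega> x)) \<bullet> (q - p)"
    using \<gamma> by (simp add: zero_le_mult_iff zero_le_divide_iff)
  also have "\<dots> \<le> norm (\<gamma> *\<^sub>R (g - g') + (D\<omega> y - D\<omega> x)) * norm (q - p)"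
    by (rule norm_cauchy_schwarz)
  finally have "\<alpha> * norm (p - q) * norm (p - q) \<le> norm (\<gamma> *\<^sub>R (g - g') + (D\<omega> y - D\<omega> x)) * norm (p - q)"
    using \<omega>_strong[OF X] by (simp add: power2_eq_square norm_minus_commute mult.assoc)
  then have "p \<noteq> q \<Longrightarrow> \<alpha> * norm (p - q) \<le> norm (\<gamma> *\<^sub>R (g - g') + (D\<omega> y - D\<omega> x))"
    by (subst (asm) mult_le_cancel_right) auto
  then show ?thesis unfolding pq[symmetric] by (cases "p = q") auto
qed

text \<open>The prox-mapping is defined through a choice of minimizer, which says nothing about
  measurability; continuity in the base point and the gradient together is what makes the iterates
  Borel.\<close>

lemma continuous_on_prox_map:
  assumes \<gamma>: "\<gamma> > 0"
  shows "continuous_on (X \<times> UNIV) (\<lambda>b. prox_map X h \<omega> D\<omega> (fst b) (snd b) \<gamma>)"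
  unfolding continuous_on_def
proof (rule ballI)
  fix a :: "'a \<times> 'a" assume a: "a \<in> X \<times> UNIV"
  let ?p = "\<lambda>b. prox_map X h \<omega> D\<omega> (fst b) (snd b) \<gamma>"
  let ?B = "\<lambda>b. norm (\<gamma> *\<^sub>R (snd b - snd a) + (D\<omega> (fst a) - D\<omega> (fst b))) / \<alpha>"
  have "continuous_on X D\<omega>" using \<omega>_C1 by (simp add: C1_on_def)
  then have "continuous_on (X \<times> UNIV) (\<lambda>b::'a \<times> 'a. D\<omega> (fst b))"
    by (rule continuous_on_compose2[OF _ continuous_on_fst[OF continuous_on_id]]) auto
  then have "continuous_on (X \<times> UNIV) ?B"
    using \<alpha>_pos by (intro continuous_intros) auto
  from this[unfolded continuous_on_def] a
  have "(?B \<longlongrightarrow> ?B a) (at a within X \<times> UNIV)" by (rule bspec)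
  then have lim: "(?B \<longlongrightarrow> 0) (at a within X \<times> UNIV)" by simp
  have "norm (?p b - ?p a) \<le> ?B b" if "b \<in> X \<times> UNIV" for b
  proof -
    have "\<alpha> * norm (?p b - ?p a) \<le> norm (\<gamma> *\<^sub>R (snd b - snd a) + (D\<omega> (fst a) - D\<omega> (fst b)))"
      using that a by (intro prox_map_lipschitz \<gamma>) (auto simp: mem_Times_iff)
    then show ?thesis using \<alpha>_pos by (simp add: pos_le_divide_eq mult.commute)
  qed
  then have "eventually (\<lambda>b. norm (?p b - ?p a) \<le> ?B b) (at a within X \<times> UNIV)"
    unfolding eventually_at_filter by (intro always_eventually allI impI) 
  then have "((\<lambda>b. ?p b - ?p a) \<longlongrightarrow> 0) (at a within X \<times> UNIV)"
    using lim by (rule Lim_null_comparison)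
  then show "(?p \<longlongrightarrow> ?p a) (at a within X \<times> UNIV)"
    by (rule LIM_zero_cancel)
qed

lemma proj_grad_lipschitz:
  assumes "x \<in> X" "\<gamma> > 0"
  shows "norm (proj_grad X h \<omega> D\<omega> x g \<gamma> - proj_grad X h \<omega> D\<omega> x g' \<gamma>) \<le> norm (g - g') / \<alpha>"
proof -
  let ?p = "\<lambda>g. prox_map X h \<omega> D\<omega> x g \<gamma>"
  have "norm (proj_grad X h \<omega> D\<omega> x g \<gamma> - proj_grad X h \<omega> D\<omega> x g' \<gamma>) = norm (?p g - ?p g') / \<gamma>"
  proof -
    have "proj_grad X h \<omega> D\<omega> x g \<gamma> - proj_grad X h \<omega> D\<omega> x g' \<gamma> = (1 / \<gamma>) *\<^sub>R (?p g' - ?p g)"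
      by (simp add: proj_grad_def algebra_simps)
    then show ?thesis using assms by (simp add: norm_minus_commute)
  qed
  also have "\<dots> \<le> norm (g - g') / \<alpha>"
  proof -
    have "\<alpha> * norm (?p g - ?p g') \<le> \<gamma> * norm (g - g')"
      using prox_map_lipschitz[of x x \<gamma> g g'] assms
      by (simp del: scaleR_diff_right)
    then show ?thesis using assms \<alpha>_pos by (simp add: pos_divide_le_eq pos_le_divide_eq mult.commute)
  qed
  finally show ?thesis .
qed

lemma prox_map_eq_proj_grad:
  "\<gamma> > 0 \<Longrightarrow> prox_map X h \<omega> D\<omega> x g \<gamma> = x - \<gamma> *\<^sub>R proj_grad X h \<omega> D\<omega> x g \<gamma>"
  by (simp add: proj_grad_def)

text \<open>Optimality of the prox point tested at \<open>u = x\<close>, with strong monotonicity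
  supplying the quadratic term.\<close>

lemma proj_grad_inner_ge:
  fixes g :: 'a
  assumes x: "x \<in> X" and \<gamma>: "\<gamma> > 0"
  defines "P \<equiv> proj_grad X h \<omega> D\<omega> x g \<gamma>"
  shows "\<gamma> * \<alpha> * (norm P)\<^sup>2 + h (x - \<gamma> *\<^sub>R P) - h x \<le> \<gamma> * (g \<bullet> P)"
proof -
  define p where "p = prox_map X h \<omega> D\<omega> x g \<gamma>"
  have p: "p \<in> X" "p = x - \<gamma> *\<^sub>R P"
    using assms by (auto simp: p_def prox_map_in P_def proj_grad_def)
  have "0 \<le> g \<bullet> (x - p) - (1 / \<gamma>) * ((x - p) \<bullet> (D\<omega> x - D\<omega> p)) + h x - h p"
  proof -
    have "(D\<omega> p - D\<omega> x) \<bullet> (x - p) = - ((x - p) \<bullet> (D\<omega> x - D\<omega> p))"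
      by (metis inner_commute inner_minus_right minus_diff_eq)
    then show ?thesis
      using prox_map_optimality[OF x \<gamma> x, of g] unfolding p_def[symmetric]
      by (simp add: inner_add_left)
  qed
  moreover have "\<alpha> * (norm (x - p))\<^sup>2 / \<gamma> \<le> (x - p) \<bullet> (D\<omega> x - D\<omega> p) / \<gamma>"
    using \<omega>_strong[OF x p(1)] \<gamma> by (intro divide_right_mono) auto
  moreover have "\<alpha> * (norm (x - p))\<^sup>2 / \<gamma> = \<gamma> * \<alpha> * (norm P)\<^sup>2"
    using \<gamma> by (simp add: p(2) power2_eq_square)
  ultimately show ?thesis using p(2) by simp
qed

section \<open>Descent of the composite objective at the stepsize of the method\<close>

abbreviation "step_grad x g \<equiv> proj_grad X h \<omega> D\<omega> x g (\<alpha> / (2 * L))"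
abbreviation "step x g \<equiv> prox_map X h \<omega> D\<omega> x g (\<alpha> / (2 * L))"
abbreviation "exact_grad x \<equiv> exact_proj_grad X Df h L \<omega> D\<omega> \<alpha> x"
abbreviation "\<Psi> x \<equiv> f x + h x"

lemma step_size_pos: "\<alpha> / (2 * L) > 0"
  using \<alpha>_pos L_pos by simp

text \<open>The cross term with the noise is split around the exact projected gradient, which unlike
  \<open>step_grad x g\<close> does not depend on the samples in \<open>g\<close>; so its expectation will vanish.\<close>
lemma step_decrease:
  assumes x: "x \<in> X"
  shows "\<Psi> (step x g) \<le> \<Psi> x - \<alpha>\<^sup>2 / (4 * L) * (norm (step_grad x g))\<^sup>2
    + \<alpha> / (2 * L) * ((g - Df x) \<bullet> exact_grad x) + (norm (g - Df x))\<^sup>2 / (2 * L)"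
proof -
  define \<gamma> where "\<gamma> = \<alpha> / (2 * L)"
  have \<gamma>: "\<gamma> > 0" using step_size_pos by (simp add: \<gamma>_def)
  define P e \<delta> where "P = step_grad x g" and "e = exact_grad x" and "\<delta> = g - Df x"
  have p: "step x g = x - \<gamma> *\<^sub>R P" "step x g \<in> X"
    unfolding P_def \<gamma>_def
    by (rule prox_map_eq_proj_grad prox_map_in x step_size_pos)+
  have "f (step x g) \<le> f x + Df x \<bullet> (- \<gamma> *\<^sub>R P) + L / 2 * (norm (- \<gamma> *\<^sub>R P))\<^sup>2"
    using lipschitz_gradient_descent[OF f_C1 X_convex x p(2) Df_lipschitz] p by simp
  also have "\<dots> = f x - \<gamma> * (Df x \<bullet> P) + L / 2 * \<gamma>\<^sup>2 * (norm P)\<^sup>2"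
    by (simp add: power_mult_distrib)
  finally have 1: "f (step x g) \<le> f x - \<gamma> * (Df x \<bullet> P) + L / 2 * \<gamma>\<^sup>2 * (norm P)\<^sup>2" .
  have 2: "\<gamma> * \<alpha> * (norm P)\<^sup>2 + h (step x g) - h x \<le> \<gamma> * (g \<bullet> P)"
    using proj_grad_inner_ge[OF x \<gamma>, of g] unfolding p(1) P_def \<gamma>_def .
  have "\<delta> \<bullet> (P - e) \<le> norm \<delta> * norm (P - e)" by (rule norm_cauchy_schwarz)
  also have "\<dots> \<le> norm \<delta> * (norm \<delta> / \<alpha>)"
    using proj_grad_lipschitz[OF x step_size_pos, of g "Df x"]
    by (intro mult_left_mono) (auto simp: P_def e_def \<delta>_def exact_proj_grad_def)
  finally have "\<gamma> * (\<delta> \<bullet> (P - e)) \<le> \<gamma> * ((norm \<delta>)\<^sup>2 / \<alpha>)"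
    using \<gamma> by (intro mult_left_mono) (auto simp: power2_eq_square)
  also have "\<dots> = (norm \<delta>)\<^sup>2 / (2 * L)" using \<alpha>_pos by (simp add: \<gamma>_def)
  finally have 3: "\<gamma> * (\<delta> \<bullet> P) \<le> \<gamma> * (\<delta> \<bullet> e) + (norm \<delta>)\<^sup>2 / (2 * L)"
    by (simp add: inner_diff_right algebra_simps)
  have "\<gamma> * (g \<bullet> P) = \<gamma> * (Df x \<bullet> P) + \<gamma> * (\<delta> \<bullet> P)"
    by (simp add: \<delta>_def inner_diff_left algebra_simps)
  \<comment> \<open>The descent estimate leaves the coefficient
    \<open>3 * \<alpha>\<^sup>2 / (8 * L)\<close>; it is weakened to two thirds of this
    value.\<close>
  moreover have "\<gamma> * \<alpha> * (norm P)\<^sup>2 - L / 2 * \<gamma>\<^sup>2 * (norm P)\<^sup>2 \<ge> \<alpha>\<^sup>2 / (4 * L) * (norm P)\<^sup>2"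
  proof -
    have "\<gamma> * \<alpha> - L / 2 * \<gamma>\<^sup>2 = 3 * (\<alpha>\<^sup>2 / (8 * L))"
      using L_pos by (simp add: \<gamma>_def power2_eq_square field_simps)
    moreover have "\<alpha>\<^sup>2 / (4 * L) = 2 * (\<alpha>\<^sup>2 / (8 * L))" "\<alpha>\<^sup>2 / (8 * L) \<ge> 0"
      using L_pos by simp_all
    ultimately have "\<alpha>\<^sup>2 / (4 * L) \<le> \<gamma> * \<alpha> - L / 2 * \<gamma>\<^sup>2" by linarith
    from mult_right_mono[OF this, of "(norm P)\<^sup>2"] show ?thesis by (simp add: left_diff_distrib)
  qed
  ultimately have "\<Psi> (step x g) \<le> \<Psi> x - \<alpha>\<^sup>2 / (4 * L) * (norm P)\<^sup>2 + \<gamma> * (\<delta> \<bullet> e) + (norm \<delta>)\<^sup>2 / (2 * L)"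
    using 1 2 3 by linarith
  then show ?thesis by (simp add: P_def e_def \<delta>_def \<gamma>_def)
qed

definition "\<Psi>_star = (INF x\<in>X. \<Psi> x)"

lemma \<Psi>_star_le: "x \<in> X \<Longrightarrow> \<Psi>_star \<le> \<Psi> x"
  unfolding \<Psi>_star_def using Psi_bounded by (rule cINF_lower)

lemma D_Psi_squared: "x \<in> X \<Longrightarrow> L * (D_Psi X f h L x)\<^sup>2 = \<Psi> x - \<Psi>_star"
  using \<Psi>_star_le[of x] L_pos by (simp add: D_Psi_def \<Psi>_star_def)

text \<open>For \<open>g = Df x\<close> both noise terms of the descent inequality vanish, and the
  new objective value is at least \<open>\<Psi>_star\<close>. This gives integrability along the run
  and handles the last iterate.\<close>

lemma exact_grad_le_gap:
  assumes "x \<in> X"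
  shows "\<alpha>\<^sup>2 / (4 * L) * (norm (exact_grad x))\<^sup>2 \<le> \<Psi> x - \<Psi>_star"
  using step_decrease[OF assms, of "Df x"] \<Psi>_star_le[OF prox_map_in[OF assms step_size_pos, of "Df x"]]
  by (simp add: exact_proj_grad_def)

lemma exact_grad_step_grad_diff:
  "x \<in> X \<Longrightarrow> norm (exact_grad x - step_grad x g) \<le> norm (g - Df x) / \<alpha>"
  using proj_grad_lipschitz[OF _ step_size_pos, of x "Df x" g]
  by (simp add: exact_proj_grad_def norm_minus_commute)

section \<open>Measurability of prox steps and projected gradients\<close>

lemma borel_measurable_step:
  assumes "x \<in> M \<rightarrow>\<^sub>M restrict_space borel X" "g \<in> borel_measurable M"
  shows "(\<lambda>w. step (x w) (g w)) \<in> M \<rightarrow>\<^sub>M restrict_space borel X"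
proof -
  have "(\<lambda>a. step (fst a) (snd a)) \<in> borel_measurable (restrict_space borel (X \<times> UNIV))"
    by (intro borel_measurable_continuous_on_restrict continuous_on_prox_map step_size_pos)
  moreover have "(\<lambda>w. (x w, g w)) \<in> M \<rightarrow>\<^sub>M restrict_space borel (X \<times> UNIV)"
    using assms by (auto simp: measurable_restrict_space2_iff borel_measurable_Pair)
  ultimately have "(\<lambda>w. step (x w) (g w)) \<in> borel_measurable M"
    using measurable_compose[of "\<lambda>w. (x w, g w)" M _ "\<lambda>a. step (fst a) (snd a)"] by simp
  then show ?thesis
    using assms(1)
    by (auto simp: measurable_restrict_space2_iff intro!: prox_map_in step_size_pos)
qed

lemma borel_measurable_step_grad:
  assumes "x \<in> M \<rightarrow>\<^sub>M restrict_space borel X" "g \<in> borel_measurable M"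
  shows "(\<lambda>w. step_grad (x w) (g w)) \<in> borel_measurable M"
proof -
  have "(\<lambda>w. step (x w) (g w)) \<in> borel_measurable M" "x \<in> borel_measurable M"
    using borel_measurable_step[OF assms] assms(1) by (auto simp: measurable_restrict_space2_iff)
  then show ?thesis unfolding proj_grad_def by measurable
qed

lemma borel_measurable_gradient:
  assumes "x \<in> M \<rightarrow>\<^sub>M restrict_space borel X"
  shows "(\<lambda>w. Df (x w)) \<in> borel_measurable M"
proof -
  have "Df \<in> borel_measurable (restrict_space borel X)"
    using f_C1 by (intro borel_measurable_continuous_on_restrict) (simp add: C1_on_def)
  with assms show ?thesis by (rule measurable_compose)
qed

lemma borel_measurable_exact_grad:
  assumes "x \<in> M \<rightarrow>\<^sub>M restrict_space borel X"
  shows "(\<lambda>w. exact_grad (x w)) \<in> borel_measurable M"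
  unfolding exact_proj_grad_def
  using assms borel_measurable_gradient by (intro borel_measurable_step_grad)

end

section \<open>Second moments of the oracle noise\<close>

lemma integrable_norm_mult_norm:
  fixes Y :: "'w \<Rightarrow> 'a::euclidean_space" and Z :: "'w \<Rightarrow> 'b::euclidean_space"
  assumes [measurable]: "Y \<in> borel_measurable M" "Z \<in> borel_measurable M"
    and "integrable M (\<lambda>w. (norm (Y w))\<^sup>2)" "integrable M (\<lambda>w. (norm (Z w))\<^sup>2)"
  shows "integrable M (\<lambda>w. norm (Y w) * norm (Z w))"
proof (rule Bochner_Integration.integrable_bound)
  show "integrable M (\<lambda>w. (norm (Y w))\<^sup>2 + (norm (Z w))\<^sup>2)"
    using assms by simp
  have "norm (Y w) * norm (Z w) \<le> (norm (Y w))\<^sup>2 + (norm (Z w))\<^sup>2" for w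
    using sum_squares_bound[of "norm (Y w)" "norm (Z w)"] mult_nonneg_nonneg[OF norm_ge_zero[of "Y w"] norm_ge_zero[of "Z w"]]
    by linarith
  then show "AE w in M. norm (norm (Y w) * norm (Z w)) \<le> norm ((norm (Y w))\<^sup>2 + (norm (Z w))\<^sup>2)"
    by simp
qed simp

lemma integrable_inner:
  fixes Y Z :: "'w \<Rightarrow> 'a::euclidean_space"
  assumes [measurable]: "Y \<in> borel_measurable M" "Z \<in> borel_measurable M"
    and "integrable M (\<lambda>w. (norm (Y w))\<^sup>2)" "integrable M (\<lambda>w. (norm (Z w))\<^sup>2)"
  shows "integrable M (\<lambda>w. Y w \<bullet> Z w)"
  by (rule Bochner_Integration.integrable_bound[OF integrable_norm_mult_norm[OF assms]])
    (simp_all add: Cauchy_Schwarz_ineq2)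

context prob_space
begin

lemma oracle_reply_measurable: "oracle_reply M F Df \<sigma> x Y \<Longrightarrow> Y \<in> borel_measurable M"
  unfolding oracle_reply_def by (auto intro: borel_measurable_integrable)

lemma oracle_noise_moment:
  fixes Y :: "'a \<Rightarrow> 'b::euclidean_space"
  assumes sub: "subalgebra M F" and reply: "oracle_reply M F Df \<sigma> x Y"
    and meas: "(\<lambda>w. Df (x w)) \<in> borel_measurable F"
  shows "integrable M (\<lambda>w. (norm (Y w - Df (x w)))\<^sup>2)"
    and "(\<integral>w. (norm (Y w - Df (x w)))\<^sup>2 \<partial>M) \<le> \<sigma>\<^sup>2"
proof -
  interpret finite_measure_subalgebra M F by unfold_locales (rule sub)
  have [measurable]: "(\<lambda>w. Df (x w)) \<in> borel_measurable M" "Y \<in> borel_measurable M"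
    using measurable_from_subalg[OF sub meas] oracle_reply_measurable[OF reply] by auto
  have "(\<integral>\<^sup>+w. ennreal ((norm (Y w - Df (x w)))\<^sup>2) \<partial>M)
      = (\<integral>\<^sup>+w. nn_cond_exp M F (\<lambda>w. ennreal ((norm (Y w - Df (x w)))\<^sup>2)) w \<partial>M)"
    using nn_cond_exp_intg[of "\<lambda>_. 1" "\<lambda>w. ennreal ((norm (Y w - Df (x w)))\<^sup>2)"] by simp
  also have "\<dots> \<le> (\<integral>\<^sup>+w. ennreal (\<sigma>\<^sup>2) \<partial>M)"
    using reply unfolding oracle_reply_def by (intro nn_integral_mono_AE) auto
  finally have le: "(\<integral>\<^sup>+w. ennreal ((norm (Y w - Df (x w)))\<^sup>2) \<partial>M) \<le> ennreal (\<sigma>\<^sup>2)"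
    by (simp add: emeasure_space_1)
  show int: "integrable M (\<lambda>w. (norm (Y w - Df (x w)))\<^sup>2)"
    using le by (intro integrableI_bounded) (auto simp: top_unique less_top[symmetric] intro: le_less_trans)
  show "(\<integral>w. (norm (Y w - Df (x w)))\<^sup>2 \<partial>M) \<le> \<sigma>\<^sup>2"
    using le nn_integral_eq_integral[OF int] by simp
qed

text \<open>A factor known to \<open>F\<close> can be pulled out of the conditional expectation, and
  the conditional mean of the noise is zero. The argument runs over basis components because the
  conditional expectation is real-valued; Cauchy-Schwarz makes every product integrable.\<close>

lemma oracle_noise_orthogonal:
  fixes Y :: "'a \<Rightarrow> 'b::euclidean_space"
  assumes sub: "subalgebra M F" and reply: "oracle_reply M F Df \<sigma> x Y"
    and meas: "(\<lambda>w. Df (x w)) \<in> borel_measurable F"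
    and Z: "Z \<in> borel_measurable F" "integrable M (\<lambda>w. (norm (Z w))\<^sup>2)"
  shows "(\<integral>w. Z w \<bullet> (Y w - Df (x w)) \<partial>M) = 0"
proof -
  interpret finite_measure_subalgebra M F by unfold_locales (rule sub)
  define D where "D w = Y w - Df (x w)" for w
  have [measurable]: "(\<lambda>w. Df (x w)) \<in> borel_measurable M" "Y \<in> borel_measurable M" "Z \<in> borel_measurable M"
    using measurable_from_subalg[OF sub] meas Z oracle_reply_measurable[OF reply] by auto
  have [measurable]: "D \<in> borel_measurable M" unfolding D_def by measurable
  have D2: "integrable M (\<lambda>w. (norm (D w))\<^sup>2)"
    using oracle_noise_moment(1)[OF sub reply meas] by (simp add: D_def)
  have prod: "integrable M (\<lambda>w. norm (Z w) * norm (D w))"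
    using Z D2 by (intro integrable_norm_mult_norm) auto
  have comp: "integrable M (\<lambda>w. (Z w \<bullet> b) * (D w \<bullet> b)) \<and> (\<integral>w. (Z w \<bullet> b) * (D w \<bullet> b) \<partial>M) = 0"
    if b: "b \<in> Basis" for b
  proof
    have Yb: "integrable M (\<lambda>w. Y w \<bullet> b)"
      and cond: "AE w in M. real_cond_exp M F (\<lambda>w. Y w \<bullet> b) w = Df (x w) \<bullet> b"
      using reply b unfolding oracle_reply_def by auto
    have Df_F [measurable]: "(\<lambda>w. Df (x w) \<bullet> b) \<in> borel_measurable F"
      using meas by simp
    \<comment> \<open>Integrability of \<open>Df (x w) \<bullet> b\<close> is no assumption; it is
      inherited from the conditional expectation, with which it agrees almost everywhere.\<close>
    have "integrable M (real_cond_exp M F (\<lambda>w. Y w \<bullet> b))"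
      using Yb by (rule real_cond_exp_int)
    then have Dfb: "integrable M (\<lambda>w. Df (x w) \<bullet> b)"
      using cond by (subst (asm) integrable_cong_AE[where g = "\<lambda>w. Df (x w) \<bullet> b"]) auto
    have "AE w in M. real_cond_exp M F (\<lambda>w. Y w \<bullet> b - Df (x w) \<bullet> b) w
        = real_cond_exp M F (\<lambda>w. Y w \<bullet> b) w - real_cond_exp M F (\<lambda>w. Df (x w) \<bullet> b) w"
      using Yb Dfb by (rule real_cond_exp_diff)
    then have zero: "AE w in M. real_cond_exp M F (\<lambda>w. D w \<bullet> b) w = 0"
      using cond real_cond_exp_F_meas[OF Dfb Df_F] unfolding D_def inner_diff_left by eventually_elim simp
    have le: "\<bar>(Z w \<bullet> b) * (D w \<bullet> b)\<bar> \<le> norm (Z w) * norm (D w)" for w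
      using b by (auto simp: abs_mult intro!: mult_mono Basis_le_norm)
    show int: "integrable M (\<lambda>w. (Z w \<bullet> b) * (D w \<bullet> b))"
      by (rule Bochner_Integration.integrable_bound[OF prod]) (use le in auto)
    have "(\<integral>w. (Z w \<bullet> b) * (D w \<bullet> b) \<partial>M) = (\<integral>w. (Z w \<bullet> b) * real_cond_exp M F (\<lambda>w. D w \<bullet> b) w \<partial>M)"
      using Z by (intro real_cond_exp_intg(2)[symmetric] int) auto
    also have "\<dots> = (\<integral>w. 0 \<partial>M)"
      using zero by (intro integral_cong_AE) auto
    finally show "(\<integral>w. (Z w \<bullet> b) * (D w \<bullet> b) \<partial>M) = 0" by simp
  qed
  have "(\<integral>w. Z w \<bullet> D w \<partial>M) = (\<integral>w. (\<Sum>b\<in>Basis. (Z w \<bullet> b) * (D w \<bullet> b)) \<partial>M)"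
    by (subst euclidean_inner) simp
  also have "\<dots> = (\<Sum>b\<in>Basis. (\<integral>w. (Z w \<bullet> b) * (D w \<bullet> b) \<partial>M))"
    using comp by (intro Bochner_Integration.integral_sum) auto
  also have "\<dots> = 0" using comp by simp
  finally show ?thesis by (simp add: D_def)
qed

lemma oracle_average:
  fixes Y :: "nat \<Rightarrow> 'a \<Rightarrow> 'b::euclidean_space"
  assumes m: "m \<ge> 1"
    and sub: "\<And>i. i \<in> {1..m} \<Longrightarrow> subalgebra M (F i)"
    and reply: "\<And>i. i \<in> {1..m} \<Longrightarrow> oracle_reply M (F i) Df \<sigma> x (Y i)"
    and meas: "\<And>i. i \<in> {1..m} \<Longrightarrow> (\<lambda>w. Df (x w)) \<in> borel_measurable (F i)"
    and past: "\<And>i j. i \<in> {1..m} \<Longrightarrow> j \<in> {1..<i} \<Longrightarrow> Y j \<in> borel_measurable (F i)"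
  defines "E \<equiv> \<lambda>w. (1 / real m) *\<^sub>R (\<Sum>i=1..m. Y i w) - Df (x w)"
  shows "E \<in> borel_measurable M"
    and "integrable M (\<lambda>w. (norm (E w))\<^sup>2)"
    and "(\<integral>w. (norm (E w))\<^sup>2 \<partial>M) \<le> \<sigma>\<^sup>2 / real m"
    and "\<And>Z. (\<And>i. i \<in> {1..m} \<Longrightarrow> Z \<in> borel_measurable (F i)) \<Longrightarrow>
           integrable M (\<lambda>w. (norm (Z w))\<^sup>2) \<Longrightarrow> (\<integral>w. Z w \<bullet> E w \<partial>M) = 0"
proof -
  define D where "D i w = Y i w - Df (x w)" for i w
  define A where "A n w = (\<Sum>i=1..n. D i w)" for n w
  have [measurable]: "(\<lambda>w. Df (x w)) \<in> borel_measurable M"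
    using measurable_from_subalg[OF sub[of 1] meas[of 1]] m by simp
  have D_meas: "D i \<in> borel_measurable M" if "i \<in> {1..m}" for i
    unfolding D_def using oracle_reply_measurable[OF reply[OF that]] by simp
  have D_int: "integrable M (\<lambda>w. (norm (D i w))\<^sup>2)" "(\<integral>w. (norm (D i w))\<^sup>2 \<partial>M) \<le> \<sigma>\<^sup>2"
    if "i \<in> {1..m}" for i
    using oracle_noise_moment[OF sub reply meas, OF that that that] that by (simp_all add: D_def)
  have A_meas: "A n \<in> borel_measurable M" if "n \<le> m" for n
    unfolding A_def using D_meas that by (intro borel_measurable_sum) auto
  have A_int: "integrable M (\<lambda>w. (norm (A n w))\<^sup>2) \<and> (\<integral>w. (norm (A n w))\<^sup>2 \<partial>M) \<le> real n * \<sigma>\<^sup>2"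
    if "n \<le> m" for n
    using that
  proof (induction n)
    case 0
    then show ?case by (simp add: A_def)
  next
    case (Suc n)
    then have IH: "integrable M (\<lambda>w. (norm (A n w))\<^sup>2)" "(\<integral>w. (norm (A n w))\<^sup>2 \<partial>M) \<le> real n * \<sigma>\<^sup>2"
      by auto
    have n: "Suc n \<in> {1..m}" using Suc.prems by auto
    \<comment> \<open>The partial sum involves only replies before call \<open>Suc n\<close>, so it
      may serve as the factor \<open>Z\<close> in the orthogonality lemma and the cross term drops
      out.\<close>
    have "A n \<in> borel_measurable (F (Suc n))"
      unfolding A_def D_def using past[OF n] meas[OF n]
      by (intro borel_measurable_sum borel_measurable_diff) auto
    then have orth: "(\<integral>w. A n w \<bullet> D (Suc n) w \<partial>M) = 0"
      unfolding D_def using oracle_noise_orthogonal[OF sub reply meas, OF n n n] IH by blast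
    have int: "integrable M (\<lambda>w. A n w \<bullet> D (Suc n) w)"
      using D_meas[OF n] A_meas[of n] IH D_int[OF n] Suc.prems by (intro integrable_inner) auto
    have eq: "(norm (A (Suc n) w))\<^sup>2
        = (norm (A n w))\<^sup>2 + 2 * (A n w \<bullet> D (Suc n) w) + (norm (D (Suc n) w))\<^sup>2" for w
      by (simp add: A_def power2_norm_eq_inner inner_add_left inner_add_right inner_commute)
    show ?case
      unfolding eq using IH int D_int[OF n] orth by (auto simp: algebra_simps)
  qed
  have E: "E = (\<lambda>w. (1 / real m) *\<^sub>R A m w)"
  proof
    fix w
    have A: "A m w = (\<Sum>i=1..m. Y i w) - real m *\<^sub>R Df (x w)"
      by (simp add: A_def D_def sum_subtractf sum_constant_scaleR)
    show "E w = (1 / real m) *\<^sub>R A m w"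
      unfolding A E_def using m by (simp add: scaleR_diff_right)
  qed
  have E2: "(norm (E w))\<^sup>2 = (norm (A m w))\<^sup>2 / (real m)\<^sup>2" for w
    by (simp add: E power_divide)
  show "E \<in> borel_measurable M" unfolding E using A_meas[of m] by simp
  show "integrable M (\<lambda>w. (norm (E w))\<^sup>2)" unfolding E2 using A_int[of m] by simp
  have "(\<integral>w. (norm (E w))\<^sup>2 \<partial>M) \<le> real m * \<sigma>\<^sup>2 / (real m)\<^sup>2"
    unfolding E2 using A_int[of m] by (auto intro: divide_right_mono)
  then show "(\<integral>w. (norm (E w))\<^sup>2 \<partial>M) \<le> \<sigma>\<^sup>2 / real m"
    using m by (simp add: power2_eq_square)
  fix Z :: "'a \<Rightarrow> 'b"
  assume Z: "\<And>i. i \<in> {1..m} \<Longrightarrow> Z \<in> borel_measurable (F i)" "integrable M (\<lambda>w. (norm (Z w))\<^sup>2)"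
  have Z_M: "Z \<in> borel_measurable M"
    using measurable_from_subalg[OF sub[of 1] Z(1)[of 1]] m by simp
  have "(\<integral>w. Z w \<bullet> E w \<partial>M) = (\<integral>w. (\<Sum>i=1..m. (1 / real m) * (Z w \<bullet> D i w)) \<partial>M)"
    by (simp add: E A_def inner_sum_right sum_distrib_left sum_divide_distrib)
  also have "\<dots> = (\<Sum>i=1..m. (1 / real m) * (\<integral>w. Z w \<bullet> D i w \<partial>M))"
    using integrable_inner[OF Z_M D_meas Z(2) D_int(1)]
    by (subst Bochner_Integration.integral_sum) auto
  also have "\<dots> = 0"
    unfolding D_def using oracle_noise_orthogonal[OF sub reply meas Z(1) Z(2)]
    by (intro sum.neutral) simp
  finally show "(\<integral>w. Z w \<bullet> E w \<partial>M) = 0" .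
qed

end

section \<open>Measurability of the iterates\<close>

lemma subalgebra_vimage_algebra:
  assumes "f \<in> M \<rightarrow>\<^sub>M P"
  shows "subalgebra M (vimage_algebra (space M) f P)"
  unfolding subalgebra_def
  using measurable_space[OF assms] measurable_sets[OF assms]
  by (auto simp: sets_vimage_algebra2 Pi_iff)

lemma measurable_vimage_algebra_compose:
  assumes "f \<in> M \<rightarrow>\<^sub>M P" "g \<in> P \<rightarrow>\<^sub>M Q"
  shows "(\<lambda>w. g (f w)) \<in> vimage_algebra (space M) f P \<rightarrow>\<^sub>M Q"
proof -
  have "f \<in> vimage_algebra (space M) f P \<rightarrow>\<^sub>M P"
    using measurable_space[OF assms(1)] by (intro measurable_vimage_algebra1) auto
  then show ?thesis using assms(2) by (rule measurable_compose)
qed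

context two_rspg
begin

definition "calls = {1..<N} \<times> {1..m}"

definition "samples s w = (\<lambda>j\<in>calls. \<xi> s (fst j) (snd j) w)"

text \<open>The iterate as a deterministic function of one flat sample vector. Measurability on the
  product space, and with it the independence statements, can then be carried over to the
  run.\<close>

definition "iterate y k =
  rspg_iter X h \<omega> D\<omega> G (\<lambda>_. m) (\<lambda>_. \<alpha> / (2 * L)) x1 (\<lambda>k i. y (k, i)) k"

definition "batch s k w = sample_avg G (x s k w) (\<lambda>i. \<xi> s k i w) m"

lemma iterate_Suc:
  "k \<ge> 1 \<Longrightarrow> iterate y (Suc k) = step (iterate y k) (sample_avg G (iterate y k) (\<lambda>i. y (k, i)) m)"
  by (simp add: iterate_def Let_def)

lemma iterate_1: "iterate y (Suc 0) = x1" and iterate_0: "iterate y 0 = x1"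
  by (simp_all add: iterate_def)

lemma x_eq_iterate: "x s k w = iterate (\<lambda>(k, i). \<xi> s k i w) k"
  by (simp add: x_def run_iter_def iterate_def m_def)

text \<open>Iterate \<open>k\<close> reads only batches of iterations below \<open>k\<close>, so up
  to index \<open>N\<close> the samples in \<open>calls\<close> suffice. This permits replacing the
  full family by the restricted vector \<open>samples\<close>.\<close>

lemma iterate_cong:
  assumes "\<And>j. j \<in> calls \<Longrightarrow> y j = z j" "k \<le> N"
  shows "iterate y k = iterate z k"
  using assms(2)
proof (induction k)
  case (Suc k)
  show ?case
  proof (cases "k = 0")
    case False
    then have "sample_avg G (iterate z k) (\<lambda>i. y (k, i)) m = sample_avg G (iterate z k) (\<lambda>i. z (k, i)) m"
      using assms(1) Suc.prems by (auto simp: sample_avg_def calls_def intro!: sum.cong)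
    then show ?thesis using Suc False by (simp add: iterate_Suc)
  qed (simp add: iterate_1)
qed (simp add: iterate_0)

lemma x_eq_iterate_samples: "k \<le> N \<Longrightarrow> x s k w = iterate (samples s w) k"
  unfolding x_eq_iterate by (rule iterate_cong) (auto simp: samples_def)

lemma x_1: "x s 1 w = x1"
  by (simp add: x_eq_iterate iterate_1)

lemma x_Suc: "k \<ge> 1 \<Longrightarrow> x s (Suc k) w = step (x s k w) (batch s k w)"
  by (simp add: x_eq_iterate iterate_Suc batch_def)

lemma iterate_in: "iterate y k \<in> X"
proof (induction k)
  case (Suc k)
  then show ?case
    by (cases "k = 0") (auto simp: iterate_1 iterate_Suc x1_in intro!: prox_map_in step_size_pos)
qed (simp add: iterate_0 x1_in)

lemma x_in: "x s k w \<in> X"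
  by (simp add: x_eq_iterate iterate_in)

lemma xbar_eq: "xbar s w = x s (R s w) w"
  by (simp add: xbar_def x_def run_output_def)

lemma xbar_in: "xbar s w \<in> X"
  by (simp add: xbar_eq x_in)

lemma measurable_restrict_X_iff:
  "(\<And>w. g w \<in> X) \<Longrightarrow> g \<in> P \<rightarrow>\<^sub>M restrict_space borel X \<longleftrightarrow> g \<in> borel_measurable P"
  by (auto simp: measurable_restrict_space2_iff)

lemma G_compose_measurable:
  assumes "u \<in> P \<rightarrow>\<^sub>M restrict_space borel X" "z \<in> P \<rightarrow>\<^sub>M \<Xi>"
  shows "(\<lambda>w. G (u w) (z w)) \<in> borel_measurable P"
  using measurable_compose[OF measurable_Pair[OF assms] G_measurable] by simp

lemma sample_avg_measurable:
  assumes "u \<in> P \<rightarrow>\<^sub>M restrict_space borel X" "\<And>i. i \<in> {1..n} \<Longrightarrow> z i \<in> P \<rightarrow>\<^sub>M \<Xi>"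
  shows "(\<lambda>w. sample_avg G (u w) (\<lambda>i. z i w) n) \<in> borel_measurable P"
  unfolding sample_avg_def
  using assms by (intro borel_measurable_scaleR borel_measurable_sum G_compose_measurable) auto

lemma iterate_measurable:
  assumes y: "\<And>j. j \<in> calls \<Longrightarrow> y j \<in> P \<rightarrow>\<^sub>M \<Xi>" and "k \<le> N"
  shows "(\<lambda>w. iterate (\<lambda>j. y j w) k) \<in> P \<rightarrow>\<^sub>M restrict_space borel X"
  using assms(2)
proof (induction k)
  case 0
  then show ?case using x1_in by (auto simp: iterate_0 measurable_restrict_X_iff)
next
  case (Suc k)
  show ?case
  proof (cases "k = 0")
    case True
    then show ?thesis using x1_in by (auto simp: iterate_1 measurable_restrict_X_iff)
  next
    case False
    then have "(\<lambda>w. iterate (\<lambda>j. y j w) (Suc k))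
        = (\<lambda>w. step (iterate (\<lambda>j. y j w) k) (sample_avg G (iterate (\<lambda>j. y j w) k) (\<lambda>i. y (k, i) w) m))"
      by (simp add: iterate_Suc)
    moreover have "\<dots> \<in> P \<rightarrow>\<^sub>M restrict_space borel X"
      using Suc False y by (intro borel_measurable_step sample_avg_measurable) (auto simp: calls_def)
    ultimately show ?thesis by simp
  qed
qed

lemma iterate_PiM_measurable:
  "k \<le> N \<Longrightarrow> (\<lambda>y. iterate y k) \<in> PiM calls (\<lambda>_. \<Xi>) \<rightarrow>\<^sub>M restrict_space borel X"
  using iterate_measurable[of "\<lambda>j y. y j" "PiM calls (\<lambda>_. \<Xi>)" k] by auto

lemma samples_measurable: "s \<in> {1..S} \<Longrightarrow> samples s \<in> M \<rightarrow>\<^sub>M PiM calls (\<lambda>_. \<Xi>)"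
  unfolding samples_def by (intro measurable_restrict) (auto simp: calls_def intro: \<xi>_measurable)

lemma x_measurable:
  assumes "s \<in> {1..S}" "k \<le> N"
  shows "x s k \<in> M \<rightarrow>\<^sub>M restrict_space borel X"
proof -
  have "x s k = (\<lambda>w. iterate (samples s w) k)"
    using assms(2) by (auto simp: x_eq_iterate_samples)
  then show ?thesis
    using measurable_compose[OF samples_measurable iterate_PiM_measurable, OF assms] by simp
qed

lemma R_range: "s \<in> {1..S} \<Longrightarrow> w \<in> space M \<Longrightarrow> R s w \<in> {1..N}"
  using measurable_space[OF R_measurable] by simp

lemma xbar_measurable:
  assumes s: "s \<in> {1..S}"
  shows "xbar s \<in> M \<rightarrow>\<^sub>M restrict_space borel X"
proof -
  have "(\<lambda>w. x s (R s w) w) \<in> M \<rightarrow>\<^sub>M restrict_space borel X"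
    by (rule measurable_compose_countable'[where f = "x s" and g = "R s" and I = "{1..N}"])
      (use x_measurable[OF s] R_measurable[OF s] in simp_all)
  then show ?thesis by (simp add: xbar_eq[abs_def])
qed

text \<open>The current iterate belongs to the history of every call of its batch, so its exact
  projected gradient is known before each reply and is orthogonal to the batch noise. Integrability
  stays a premise of the last claim because it only becomes available during the induction over the
  iterations.\<close>

lemma batch_noise:
  assumes s: "s \<in> {1..S}" and k: "k \<in> {1..<N}" and m: "m \<ge> 1"
  shows "(\<lambda>w. batch s k w - Df (x s k w)) \<in> borel_measurable M"
    and "integrable M (\<lambda>w. (norm (batch s k w - Df (x s k w)))\<^sup>2)"
    and "(\<integral>w. (norm (batch s k w - Df (x s k w)))\<^sup>2 \<partial>M) \<le> \<sigma>\<^sup>2 / real m"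
    and "integrable M (\<lambda>w. (norm (exact_grad (x s k w)))\<^sup>2) \<Longrightarrow>
      (\<integral>w. exact_grad (x s k w) \<bullet> (batch s k w - Df (x s k w)) \<partial>M) = 0"
proof -
  let ?F = "run_history M \<Xi> (\<lambda>_. m) (x s k) (\<xi> s) k"
  define p where "p i = previous_calls (\<lambda>_. m) k i" for i
  define \<Phi> where "\<Phi> i w = (x s k w, \<lambda>j\<in>p i. \<xi> s (fst j) (snd j) w)" for i w
  have F: "?F i = vimage_algebra (space M) (\<Phi> i) (borel \<Otimes>\<^sub>M PiM (p i) (\<lambda>_. \<Xi>))" for i
    by (simp add: run_history_def \<Phi>_def[abs_def] p_def)
  have p: "j \<in> p i \<Longrightarrow> fst j \<in> {1..<N} \<and> snd j \<in> {1..m}" if "i \<in> {1..m}" for i j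
    using that k by (auto simp: p_def previous_calls_def)
  have xm: "x s k \<in> borel_measurable M"
    using x_measurable[OF s, of k] k by (auto simp: measurable_restrict_X_iff x_in)
  have \<Phi>: "\<Phi> i \<in> M \<rightarrow>\<^sub>M borel \<Otimes>\<^sub>M PiM (p i) (\<lambda>_. \<Xi>)" if i: "i \<in> {1..m}" for i
    unfolding \<Phi>_def[abs_def] using p[OF i] s
    by (intro measurable_Pair xm measurable_restrict \<xi>_measurable) auto
  have sub: "subalgebra M (?F i)" if "i \<in> {1..m}" for i
    unfolding F by (rule subalgebra_vimage_algebra[OF \<Phi>[OF that]])
  have xF: "x s k \<in> ?F i \<rightarrow>\<^sub>M restrict_space borel X" if "i \<in> {1..m}" for i
    using measurable_vimage_algebra_compose[OF \<Phi>[OF that] measurable_fst]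
    unfolding F[symmetric] \<Phi>_def by (simp add: measurable_restrict_X_iff x_in)
  have past: "(\<lambda>w. G (x s k w) (\<xi> s k j w)) \<in> borel_measurable (?F i)"
    if i: "i \<in> {1..m}" and j: "j \<in> {1..<i}" for i j
  proof (rule G_compose_measurable[OF xF[OF i]])
    have jp: "(k, j) \<in> p i" using j by (auto simp: p_def previous_calls_def)
    then have "(\<lambda>a. snd a (k, j)) \<in> borel \<Otimes>\<^sub>M PiM (p i) (\<lambda>_. \<Xi>) \<rightarrow>\<^sub>M \<Xi>"
      by (intro measurable_compose[OF measurable_snd] measurable_component_singleton)
    from measurable_vimage_algebra_compose[OF \<Phi>[OF i] this] jp
    show "\<xi> s k j \<in> ?F i \<rightarrow>\<^sub>M \<Xi>" unfolding F[symmetric] \<Phi>_def by simp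
  qed
  have eq: "batch s k w = (1 / real m) *\<^sub>R (\<Sum>i=1..m. G (x s k w) (\<xi> s k i w))" for w
    by (simp add: batch_def sample_avg_def)
  note avg = oracle_average[where F = ?F and x = "x s k" and Y = "\<lambda>i w. G (x s k w) (\<xi> s k i w)",
      OF m sub oracle_run[OF s k] borel_measurable_gradient[OF xF] past]
  show "(\<lambda>w. batch s k w - Df (x s k w)) \<in> borel_measurable M"
    "integrable M (\<lambda>w. (norm (batch s k w - Df (x s k w)))\<^sup>2)"
    "(\<integral>w. (norm (batch s k w - Df (x s k w)))\<^sup>2 \<partial>M) \<le> \<sigma>\<^sup>2 / real m"
    unfolding eq by (rule avg; assumption)+
  show "(\<integral>w. exact_grad (x s k w) \<bullet> (batch s k w - Df (x s k w)) \<partial>M) = 0"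
    if "integrable M (\<lambda>w. (norm (exact_grad (x s k w)))\<^sup>2)"
    unfolding eq by (rule avg(4); (assumption | rule borel_measurable_exact_grad[OF xF] that)?)
qed

text \<open>The history of a post-optimization call contains all candidates and the earlier samples
  at the same candidate, so the averaging lemma applies with the random point
  \<open>xbar s\<close>.\<close>

lemma post_noise:
  assumes s: "s \<in> {1..S}"
  defines "E \<equiv> \<lambda>w. sample_avg G (xbar s w) (\<lambda>k. \<zeta> s k w) T - Df (xbar s w)"
  shows "E \<in> borel_measurable M"
    and "integrable M (\<lambda>w. (norm (E w))\<^sup>2)"
    and "(\<integral>w. (norm (E w))\<^sup>2 \<partial>M) \<le> \<sigma>\<^sup>2 / real T"
proof -
  let ?F = "post_history M \<Xi> S xbar (\<zeta> s)"
  define \<Phi> where "\<Phi> k w = (\<lambda>s\<in>{1..S}. xbar s w, \<lambda>j\<in>{1..<k}. \<zeta> s j w)" for k w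
  have F: "?F k = vimage_algebra (space M) (\<Phi> k) (PiM {1..S} (\<lambda>_. borel) \<Otimes>\<^sub>M PiM {1..<k} (\<lambda>_. \<Xi>))" for k
    by (simp add: post_history_def \<Phi>_def[abs_def])
  have xm: "xbar s \<in> borel_measurable M" if "s \<in> {1..S}" for s
    using xbar_measurable[OF that] by (auto simp: measurable_restrict_X_iff xbar_in)
  have \<Phi>: "\<Phi> k \<in> M \<rightarrow>\<^sub>M PiM {1..S} (\<lambda>_. borel) \<Otimes>\<^sub>M PiM {1..<k} (\<lambda>_. \<Xi>)" if k: "k \<in> {1..T}" for k
    unfolding \<Phi>_def[abs_def] using k s
    by (intro measurable_Pair measurable_restrict xm \<zeta>_measurable) auto
  have sub: "subalgebra M (?F k)" if "k \<in> {1..T}" for k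
    unfolding F by (rule subalgebra_vimage_algebra[OF \<Phi>[OF that]])
  have xF: "xbar s \<in> ?F k \<rightarrow>\<^sub>M restrict_space borel X" if "k \<in> {1..T}" for k
  proof -
    have "(\<lambda>a. fst a s) \<in> PiM {1..S} (\<lambda>_. borel) \<Otimes>\<^sub>M PiM {1..<k} (\<lambda>_. \<Xi>) \<rightarrow>\<^sub>M (borel :: 'a measure)"
      using s by (intro measurable_compose[OF measurable_fst] measurable_component_singleton)
    from measurable_vimage_algebra_compose[OF \<Phi>[OF that] this] s
    show ?thesis unfolding F[symmetric] \<Phi>_def by (simp add: measurable_restrict_X_iff xbar_in)
  qed
  have past: "(\<lambda>w. G (xbar s w) (\<zeta> s j w)) \<in> borel_measurable (?F k)"
    if k: "k \<in> {1..T}" and j: "j \<in> {1..<k}" for k j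
  proof (rule G_compose_measurable[OF xF[OF k]])
    have "(\<lambda>a. snd a j) \<in> PiM {1..S} (\<lambda>_. borel :: 'a measure) \<Otimes>\<^sub>M PiM {1..<k} (\<lambda>_. \<Xi>) \<rightarrow>\<^sub>M \<Xi>"
      using j by (intro measurable_compose[OF measurable_snd] measurable_component_singleton)
    from measurable_vimage_algebra_compose[OF \<Phi>[OF k] this] j
    show "\<zeta> s j \<in> ?F k \<rightarrow>\<^sub>M \<Xi>" unfolding F[symmetric] \<Phi>_def by simp
  qed
  note avg = oracle_average[where F = ?F and x = "xbar s" and Y = "\<lambda>k w. G (xbar s w) (\<zeta> s k w)",
      OF T_pos sub oracle_post[OF s] borel_measurable_gradient[OF xF] past]
  show "E \<in> borel_measurable M"
    "integrable M (\<lambda>w. (norm (E w))\<^sup>2)"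
    "(\<integral>w. (norm (E w))\<^sup>2 \<partial>M) \<le> \<sigma>\<^sup>2 / real T"
    unfolding E_def sample_avg_def by (rule avg; assumption)+
qed

end

section \<open>Average squared projected gradient of a run\<close>

lemma norm_add_squared_le:
  fixes a b :: "'c::real_normed_vector"
  shows "(norm (a + b))\<^sup>2 \<le> 2 * (norm a)\<^sup>2 + 2 * (norm b)\<^sup>2"
proof -
  have "(norm (a + b))\<^sup>2 \<le> (norm a + norm b)\<^sup>2"
    by (intro power_mono norm_triangle_ineq) simp
  also have "\<dots> \<le> 2 * (norm a)\<^sup>2 + 2 * (norm b)\<^sup>2"
    using sum_squares_bound[of "norm a" "norm b"] by (simp add: power2_sum)
  finally show ?thesis .
qed

lemma integrable_norm_squared_bound:
  fixes Y :: "'w \<Rightarrow> 'a::euclidean_space"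
  assumes [measurable]: "Y \<in> borel_measurable M" and B: "integrable M B" and c: "c > 0"
    and le: "\<And>w. w \<in> space M \<Longrightarrow> c * (norm (Y w))\<^sup>2 \<le> B w"
  shows "integrable M (\<lambda>w. (norm (Y w))\<^sup>2)"
proof (rule Bochner_Integration.integrable_bound)
  show "integrable M (\<lambda>w. B w / c)" using B by simp
  have "\<bar>(norm (Y w))\<^sup>2\<bar> \<le> \<bar>B w / c\<bar>" if "w \<in> space M" for w
  proof -
    have "(norm (Y w))\<^sup>2 \<le> B w / c"
      using le[OF that] c by (simp add: pos_le_divide_eq mult.commute)
    also have "\<dots> \<le> \<bar>B w / c\<bar>" by (rule abs_ge_self)
    finally show ?thesis by (simp del: abs_divide)
  qed
  then show "AE w in M. norm ((norm (Y w))\<^sup>2) \<le> norm (B w / c)"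
    by (intro AE_I2) (simp del: abs_divide)
qed simp

context two_rspg
begin

text \<open>The lower bound on \<open>m\<close> controls the noise. The upper bound keeps the
  iteration limit large; rounding up costs at most 1, and if the quotient is at most 1 then
  \<open>m = 1\<close>.\<close>

lemma batch_size_bounds:
  shows m_pos: "m \<ge> 1" and m_le: "m \<le> Nbar"
    and m_ge_min: "min (max 1 (\<sigma> * sqrt (6 * real Nbar) / (4 * L * Dt))) (real Nbar) \<le> real m"
    and m_upper: "real m \<le> 1 + \<sigma> * sqrt (6 * real Nbar) / (4 * L * Dt)"
proof -
  define q where "q = \<sigma> * sqrt (6 * real Nbar) / (4 * L * Dt)"
  define b where "b = min (max 1 q) (real Nbar)"
  have m: "m = nat \<lceil>b\<rceil>" by (simp add: m_def batch_size_def b_def q_def)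
  have q: "q \<ge> 0" using \<sigma>_pos L_pos Dt_pos by (simp add: q_def)
  have b: "1 \<le> b" "b \<le> real Nbar" using Nbar_pos by (auto simp: b_def)
  then have rm: "real m = real_of_int \<lceil>b\<rceil>" unfolding m by simp
  have "1 \<le> real m" using b(1) le_of_int_ceiling[of b] rm by linarith
  then show "m \<ge> 1" by simp
  have "\<lceil>b\<rceil> \<le> int Nbar" using ceiling_mono[OF b(2)] by (simp only: ceiling_of_nat)
  then show "m \<le> Nbar" unfolding m by (simp only: nat_le_iff)
  show "b \<le> real m" using le_of_int_ceiling[of b] rm by simp
  show "real m \<le> 1 + q"
  proof (cases "q \<le> 1")
    case True
    then have "b \<le> 1" by (simp add: b_def)
    then have "\<lceil>b\<rceil> \<le> 1" by (simp add: ceiling_le_iff)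
    then show ?thesis using rm q by linarith
  next
    case False
    then have "b \<le> q" by (simp add: b_def)
    moreover have "real m < b + 1" unfolding rm using ceiling_correct[of b] by linarith
    ultimately show ?thesis by linarith
  qed
qed

text \<open>\<open>N\<close> is the integer quotient of \<open>Nbar\<close> by \<open>m\<close>. The
  remainder is below \<open>m\<close>, hence at most \<open>m * N\<close>, so rounding down loses at
  most a factor 2.\<close>

lemma N_pos: "N \<ge> 1" and m_mult_N_le: "m * N \<le> Nbar" and Nbar_le: "real Nbar \<le> 2 * real m * real N"
proof -
  have N: "N = Nbar div m"
    unfolding N_def iteration_limit_def m_def[symmetric] by (simp add: floor_divide_of_nat_eq)
  show 1: "N \<ge> 1" unfolding N using m_pos m_le by (simp add: Suc_le_eq div_greater_zero_iff)
  show "m * N \<le> Nbar" unfolding N by simp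
  have "Nbar = m * N + Nbar mod m" unfolding N by simp
  moreover have "Nbar mod m < m" using m_pos by simp
  moreover have "m \<le> m * N" using 1 by simp
  ultimately have "Nbar \<le> 2 * m * N" by linarith
  then have "real Nbar \<le> real (2 * m * N)" by (rule of_nat_mono)
  then show "real Nbar \<le> 2 * real m * real N" by simp
qed

text \<open>The coefficient of the squared projected gradient in the one-step descent; it also
  equals the unnormalized weight \<open>\<alpha> * \<gamma> - L * \<gamma>\<^sup>2\<close> of every
  index at the constant stepsize.\<close>

definition "kappa = \<alpha>\<^sup>2 / (4 * L)"

lemma kappa_pos: "kappa > 0"
  using \<alpha>_pos L_pos by (simp add: kappa_def)

lemma exact_grad_x_measurable:
  "s \<in> {1..S} \<Longrightarrow> k \<le> N \<Longrightarrow> (\<lambda>w. exact_grad (x s k w)) \<in> borel_measurable M"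
  by (intro borel_measurable_exact_grad x_measurable)

lemma batch_measurable:
  "s \<in> {1..S} \<Longrightarrow> k \<in> {1..<N} \<Longrightarrow> batch s k \<in> borel_measurable M"
  unfolding batch_def[abs_def]
  by (intro sample_avg_measurable x_measurable) (auto intro: \<xi>_measurable)

text \<open>\<open>h\<close> need not be Borel on the boundary of \<open>X\<close>, so \<open>\<Psi> (x s k w)\<close> cannot be integrated
  directly; the right-hand sides of the step inequalities supply a measurable majorant \<open>U\<close>.\<close>
lemma majorant_exists:
  assumes s: "s \<in> {1..S}" and k: "k \<in> {1..N}"
  shows "\<exists>U. integrable M U \<and> (\<forall>w\<in>space M. \<Psi> (x s k w) \<le> U w)
    \<and> (\<forall>j\<in>{1..<k}. integrable M (\<lambda>w. (norm (step_grad (x s j w) (batch s j w)))\<^sup>2))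
    \<and> (\<integral>w. U w \<partial>M) + kappa * (\<Sum>j=1..<k. \<integral>w. (norm (step_grad (x s j w) (batch s j w)))\<^sup>2 \<partial>M)
        \<le> \<Psi> x1 + real (k - 1) * (\<sigma>\<^sup>2 / (2 * L * real m))"
proof -
  have "1 \<le> k" "k \<le> N" using k by auto
  then show ?thesis
  proof (induction k rule: dec_induct)
    case base
    show ?case by (rule exI[of _ "\<lambda>_. \<Psi> x1"]) (simp add: x_1[unfolded One_nat_def] prob_space)
  next
    case (step k)
    then have kN: "k \<in> {1..<N}" and k1: "k \<ge> 1" by auto
    obtain U where U: "integrable M U" "\<And>w. w \<in> space M \<Longrightarrow> \<Psi> (x s k w) \<le> U w"
      and past: "\<And>j. j \<in> {1..<k} \<Longrightarrow> integrable M (\<lambda>w. (norm (step_grad (x s j w) (batch s j w)))\<^sup>2)"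
      and U_le: "(\<integral>w. U w \<partial>M) + kappa * (\<Sum>j=1..<k. \<integral>w. (norm (step_grad (x s j w) (batch s j w)))\<^sup>2 \<partial>M)
        \<le> \<Psi> x1 + real (k - 1) * (\<sigma>\<^sup>2 / (2 * L * real m))"
      using step by auto
    have [measurable]: "U \<in> borel_measurable M" using U(1) by (rule borel_measurable_integrable)
    define e E g where "e w = exact_grad (x s k w)" and "E w = batch s k w - Df (x s k w)"
      and "g w = step_grad (x s k w) (batch s k w)" for w
    note noise = batch_noise[OF s kN m_pos, folded E_def]
    have [measurable]: "e \<in> borel_measurable M" "E \<in> borel_measurable M" "g \<in> borel_measurable M"
      using exact_grad_x_measurable[OF s, of k] noise(1) kN
        borel_measurable_step_grad[OF x_measurable[OF s, of k] batch_measurable[OF s kN]]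
      by (auto simp: e_def[abs_def] E_def[abs_def] g_def[abs_def])
    \<comment> \<open>The majorant of the current objective value already dominates the exact
      projected gradient; only with this is the mean of the cross term known to vanish.\<close>
    have e2: "integrable M (\<lambda>w. (norm (e w))\<^sup>2)"
    proof (rule integrable_norm_squared_bound[OF _ _ kappa_pos])
      show "integrable M (\<lambda>w. U w - \<Psi>_star)" using U(1) by simp
      show "kappa * (norm (e w))\<^sup>2 \<le> U w - \<Psi>_star" if "w \<in> space M" for w
        using exact_grad_le_gap[OF x_in, of s k w] U(2)[OF that] by (simp add: e_def kappa_def)
    qed simp
    have eE: "integrable M (\<lambda>w. e w \<bullet> E w)"
      using e2 noise(2) unfolding E_def[symmetric] by (intro integrable_inner) simp_all
    have eE_0: "(\<integral>w. e w \<bullet> E w \<partial>M) = 0"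
      using noise(4) e2 unfolding e_def E_def by simp
    \<comment> \<open>The right-hand side of the descent inequality without its negative term, with
      the objective value replaced by its majorant \<open>U\<close>.\<close>
    define V where "V w = U w + \<alpha> / (2 * L) * (e w \<bullet> E w) + (norm (E w))\<^sup>2 / (2 * L)" for w
    have V: "integrable M V" unfolding V_def using U(1) eE eE_0 noise(2) by simp
    have [measurable]: "V \<in> borel_measurable M" using V by (rule borel_measurable_integrable)
    have V_ge: "\<Psi> (x s (Suc k) w) + kappa * (norm (g w))\<^sup>2 \<le> V w" if "w \<in> space M" for w
      using step_decrease[OF x_in, of s k w "batch s k w"] U(2)[OF that] x_Suc[OF k1, of s w]
      by (simp add: V_def e_def E_def g_def kappa_def inner_commute)
    have g2: "integrable M (\<lambda>w. (norm (g w))\<^sup>2)"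
    proof (rule integrable_norm_squared_bound[OF _ _ kappa_pos])
      show "integrable M (\<lambda>w. V w - \<Psi>_star)" using V by simp
      show "kappa * (norm (g w))\<^sup>2 \<le> V w - \<Psi>_star" if "w \<in> space M" for w
        using \<Psi>_star_le[OF x_in, of s "Suc k" w] V_ge[OF that] by linarith
    qed simp
    \<comment> \<open>Putting the negative term back gives the next majorant. It could not enter
      earlier, since its integrability is derived from \<open>V\<close>.\<close>
    define W where "W w = V w - kappa * (norm (g w))\<^sup>2" for w
    have W: "integrable M W" unfolding W_def using V g2 by simp
    have "(\<integral>w. V w \<partial>M) = (\<integral>w. U w \<partial>M) + (\<integral>w. (norm (E w))\<^sup>2 \<partial>M) / (2 * L)"
      unfolding V_def using U(1) eE eE_0 noise(2) by simp
    also have "\<dots> \<le> (\<integral>w. U w \<partial>M) + \<sigma>\<^sup>2 / real m / (2 * L)"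
      using noise(3) L_pos by (intro add_left_mono divide_right_mono) auto
    finally have V_le: "(\<integral>w. V w \<partial>M) \<le> (\<integral>w. U w \<partial>M) + \<sigma>\<^sup>2 / (2 * L * real m)"
      by (simp add: mult.commute)
    have W_eq: "(\<integral>w. W w \<partial>M) = (\<integral>w. V w \<partial>M) - kappa * (\<integral>w. (norm (g w))\<^sup>2 \<partial>M)"
      unfolding W_def using V g2 by simp
    have "{1..<Suc k} = insert k {1..<k}" using k1 by auto
    then have sum: "(\<Sum>j=1..<Suc k. \<integral>w. (norm (step_grad (x s j w) (batch s j w)))\<^sup>2 \<partial>M)
        = (\<Sum>j=1..<k. \<integral>w. (norm (step_grad (x s j w) (batch s j w)))\<^sup>2 \<partial>M) + (\<integral>w. (norm (g w))\<^sup>2 \<partial>M)"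
      by (simp add: g_def)
    have "real (Suc k - 1) = real (k - 1) + 1" using k1 by simp
    then have count: "real (Suc k - 1) * (\<sigma>\<^sup>2 / (2 * L * real m))
        = real (k - 1) * (\<sigma>\<^sup>2 / (2 * L * real m)) + \<sigma>\<^sup>2 / (2 * L * real m)"
      by (simp only: distrib_right mult_1_left)
    have bound: "(\<integral>w. W w \<partial>M) + kappa * (\<Sum>j=1..<Suc k. \<integral>w. (norm (step_grad (x s j w) (batch s j w)))\<^sup>2 \<partial>M)
        \<le> \<Psi> x1 + real (Suc k - 1) * (\<sigma>\<^sup>2 / (2 * L * real m))"
      unfolding sum W_eq count distrib_left using U_le V_le by linarith
    show ?case
    proof (intro exI[of _ W] conjI ballI)
      show "\<Psi> (x s (Suc k) w) \<le> W w" if "w \<in> space M" for w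
        using V_ge[OF that] by (simp add: W_def)
      show "integrable M (\<lambda>w. (norm (step_grad (x s j w) (batch s j w)))\<^sup>2)" if "j \<in> {1..<Suc k}" for j
        using that past[of j] g2 by (cases "j = k") (auto simp: g_def)
    qed (rule W bound)+
  qed
qed

text \<open>For \<open>k < N\<close> the exact projected gradient is replaced by the stochastic one
  at the cost of a factor 2 and squared noise. Apart from the division by
  \<open>\<alpha>\<^sup>2\<close>, the telescoped noise contributes
  \<open>4 * \<sigma>\<^sup>2 / m\<close> per iteration and this replacement
  \<open>2 * \<sigma>\<^sup>2 / m\<close>, hence the 6; the 8 is \<open>2 / kappa\<close> times the
  initial gap.\<close>

lemma exact_grad_sum_bound:
  assumes s: "s \<in> {1..S}"
  shows "\<And>k. k \<in> {1..N} \<Longrightarrow> integrable M (\<lambda>w. (norm (exact_grad (x s k w)))\<^sup>2)"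
    and "(\<Sum>k=1..N. \<integral>w. (norm (exact_grad (x s k w)))\<^sup>2 \<partial>M)
      \<le> (8 * L\<^sup>2 * (D_Psi X f h L x1)\<^sup>2 + 6 * real N * \<sigma>\<^sup>2 / real m) / \<alpha>\<^sup>2"
proof -
  obtain U where U: "integrable M U" "\<And>w. w \<in> space M \<Longrightarrow> \<Psi> (x s N w) \<le> U w"
    and g2: "\<And>j. j \<in> {1..<N} \<Longrightarrow> integrable M (\<lambda>w. (norm (step_grad (x s j w) (batch s j w)))\<^sup>2)"
    and U_le: "(\<integral>w. U w \<partial>M) + kappa * (\<Sum>j=1..<N. \<integral>w. (norm (step_grad (x s j w) (batch s j w)))\<^sup>2 \<partial>M)
      \<le> \<Psi> x1 + real (N - 1) * (\<sigma>\<^sup>2 / (2 * L * real m))"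
    using majorant_exists[OF s, of N] N_pos by auto
  define e2 g2i E2 where "e2 k = (\<integral>w. (norm (exact_grad (x s k w)))\<^sup>2 \<partial>M)"
    and "g2i k = (\<integral>w. (norm (step_grad (x s k w) (batch s k w)))\<^sup>2 \<partial>M)"
    and "E2 k = (\<integral>w. (norm (batch s k w - Df (x s k w)))\<^sup>2 \<partial>M)" for k
  have gap: "kappa * (norm (exact_grad (x s N w)))\<^sup>2 \<le> U w - \<Psi>_star" if "w \<in> space M" for w
    using exact_grad_le_gap[OF x_in, of s N w] U(2)[OF that] by (simp add: kappa_def)
  have last: "integrable M (\<lambda>w. (norm (exact_grad (x s N w)))\<^sup>2)"
    using exact_grad_x_measurable[OF s, of N] U(1) gap
    by (intro integrable_norm_squared_bound[where B = "\<lambda>w. U w - \<Psi>_star", OF _ _ kappa_pos]) auto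
  have "kappa * e2 N = (\<integral>w. kappa * (norm (exact_grad (x s N w)))\<^sup>2 \<partial>M)"
    by (simp add: e2_def)
  also have "\<dots> \<le> (\<integral>w. U w - \<Psi>_star \<partial>M)"
    using last U(1) gap by (intro integral_mono) auto
  also have "\<dots> = (\<integral>w. U w \<partial>M) - \<Psi>_star"
    using U(1) by (simp add: prob_space)
  finally have last_le: "kappa * e2 N \<le> (\<integral>w. U w \<partial>M) - \<Psi>_star" .
  have step: "integrable M (\<lambda>w. (norm (exact_grad (x s k w)))\<^sup>2) \<and> e2 k \<le> 2 * g2i k + 2 * \<sigma>\<^sup>2 / (\<alpha>\<^sup>2 * real m)"
    if k: "k \<in> {1..<N}" for k
  proof -
    note noise = batch_noise[OF s k m_pos]
    let ?b = "\<lambda>w. 2 * (norm (step_grad (x s k w) (batch s k w)))\<^sup>2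
      + 2 / \<alpha>\<^sup>2 * (norm (batch s k w - Df (x s k w)))\<^sup>2"
    have le: "(norm (exact_grad (x s k w)))\<^sup>2 \<le> ?b w" for w
    proof -
      have "(norm (exact_grad (x s k w) - step_grad (x s k w) (batch s k w)))\<^sup>2
          \<le> (norm (batch s k w - Df (x s k w)) / \<alpha>)\<^sup>2"
        using exact_grad_step_grad_diff[OF x_in] by (intro power_mono) auto
      then show ?thesis
        using norm_add_squared_le[of "step_grad (x s k w) (batch s k w)"
            "exact_grad (x s k w) - step_grad (x s k w) (batch s k w)"]
        by (simp add: power_divide)
    qed
    have b: "integrable M ?b" using g2[OF k] noise(2) by simp
    have int: "integrable M (\<lambda>w. (norm (exact_grad (x s k w)))\<^sup>2)"
    proof (rule Bochner_Integration.integrable_bound[OF b])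
      show "AE w in M. norm ((norm (exact_grad (x s k w)))\<^sup>2) \<le> norm (?b w)"
        using le by (intro AE_I2) (auto intro: order_trans)
    qed (use exact_grad_x_measurable[OF s, of k] k in simp)
    have "e2 k \<le> (\<integral>w. ?b w \<partial>M)"
      unfolding e2_def using int b le by (intro integral_mono) auto
    also have "\<dots> = 2 * g2i k + 2 / \<alpha>\<^sup>2 * E2 k"
      unfolding g2i_def E2_def using g2[OF k] noise(2) by simp
    also have "\<dots> \<le> 2 * g2i k + 2 / \<alpha>\<^sup>2 * (\<sigma>\<^sup>2 / real m)"
      using noise(3) by (intro add_left_mono mult_left_mono) (auto simp: E2_def)
    finally show ?thesis using int by simp
  qed
  show "integrable M (\<lambda>w. (norm (exact_grad (x s k w)))\<^sup>2)" if "k \<in> {1..N}" for k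
    using step[of k] last that by (cases "k = N") auto
  have nn: "e2 N \<ge> 0" by (simp add: e2_def)
  have "(\<Sum>k=1..N. e2 k) = (\<Sum>k=1..<N. e2 k) + e2 N"
  proof -
    have "{1..N} = insert N {1..<N}" using N_pos by auto
    then show ?thesis by simp
  qed
  \<comment> \<open>The last term is doubled only so that it can be absorbed, together with the
    stochastic terms, by the telescoped inequality.\<close>
  also have "\<dots> \<le> (\<Sum>k=1..<N. 2 * g2i k + 2 * \<sigma>\<^sup>2 / (\<alpha>\<^sup>2 * real m)) + 2 * e2 N"
    using step nn by (intro add_mono sum_mono) auto
  also have "\<dots> = 2 * ((\<Sum>k=1..<N. g2i k) + e2 N) + real (N - 1) * (2 * \<sigma>\<^sup>2 / (\<alpha>\<^sup>2 * real m))"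
    by (simp add: sum.distrib sum_distrib_left)
  also have "(\<Sum>k=1..<N. g2i k) + e2 N
      \<le> (L * (D_Psi X f h L x1)\<^sup>2 + real (N - 1) * (\<sigma>\<^sup>2 / (2 * L * real m))) / kappa"
  proof -
    have "((\<Sum>k=1..<N. g2i k) + e2 N) * kappa
        \<le> L * (D_Psi X f h L x1)\<^sup>2 + real (N - 1) * (\<sigma>\<^sup>2 / (2 * L * real m))"
      using U_le[folded g2i_def] last_le D_Psi_squared[OF x1_in]
      distrib_left[of kappa "\<Sum>k=1..<N. g2i k" "e2 N"]
      unfolding mult.commute[of _ kappa] by linarith
    then show ?thesis using kappa_pos by (simp add: pos_le_divide_eq)
  qed
  also have "2 * ((L * (D_Psi X f h L x1)\<^sup>2 + real (N - 1) * (\<sigma>\<^sup>2 / (2 * L * real m))) / kappa)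
        + real (N - 1) * (2 * \<sigma>\<^sup>2 / (\<alpha>\<^sup>2 * real m))
      = (8 * L\<^sup>2 * (D_Psi X f h L x1)\<^sup>2 + 6 * real (N - 1) * \<sigma>\<^sup>2 / real m) / \<alpha>\<^sup>2"
    using L_pos \<alpha>_pos m_pos by (simp add: kappa_def field_simps power2_eq_square)
  also have "\<dots> \<le> (8 * L\<^sup>2 * (D_Psi X f h L x1)\<^sup>2 + 6 * real N * \<sigma>\<^sup>2 / real m) / \<alpha>\<^sup>2"
    by (intro divide_right_mono add_left_mono mult_right_mono mult_left_mono) auto
  finally show "(\<Sum>k=1..N. \<integral>w. (norm (exact_grad (x s k w)))\<^sup>2 \<partial>M)
      \<le> (8 * L\<^sup>2 * (D_Psi X f h L x1)\<^sup>2 + 6 * real N * \<sigma>\<^sup>2 / real m) / \<alpha>\<^sup>2"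
    by (simp add: e2_def)
qed

end

section \<open>Failure probabilities\<close>

context two_rspg
begin

section \<open>The bound on the mean and the failure of runs\<close>

abbreviation "DPsi \<equiv> D_Psi X f h L x1"
abbreviation "BN \<equiv> B_bound L \<sigma> DPsi Dt Nbar"

text \<open>With the quotient \<open>q\<close> from the batch size, the first term is at most
  \<open>16 * L * DPsi\<^sup>2 * (1 + q) / Nbar\<close> and the second, without the cap, at most
  \<open>6 * \<sigma>\<^sup>2 / (L * q)\<close>. This \<open>q\<close> is the value that balances
  their \<open>q\<close>-dependent parts when \<open>DPsi\<close> is replaced by
  \<open>Dt\<close>.\<close>

lemma B_bound_ge: "8 * L * DPsi\<^sup>2 / real N + 6 * \<sigma>\<^sup>2 / (L * real m) \<le> BN"
proof -
  define q where "q = \<sigma> * sqrt (6 * real Nbar) / (4 * L * Dt)"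
  define n where "n = sqrt (real Nbar)"
  have n: "n > 0" "real Nbar = n * n" using Nbar_pos by (auto simp: n_def)
  have q6: "sqrt 6 * sqrt 6 = (6::real)" by simp
  have q: "q = sqrt 6 * \<sigma> * n / (4 * L * Dt)" by (simp add: q_def n_def real_sqrt_mult)
  have qpos: "q > 0" using \<sigma>_pos n L_pos Dt_pos by (simp add: q)
  have mN: "real m \<ge> 1" "real N \<ge> 1" using m_pos N_pos by auto
  have "1 / real N \<le> 2 * real m / real Nbar"
    using Nbar_le mN n by (simp add: divide_simps mult.commute)
  also have "\<dots> \<le> 2 * (1 + q) / real Nbar"
    using m_upper by (intro divide_right_mono mult_left_mono) (auto simp: q_def)
  finally have "8 * L * DPsi\<^sup>2 * (1 / real N) \<le> 8 * L * DPsi\<^sup>2 * (2 * (1 + q) / real Nbar)"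
    using L_pos by (intro mult_left_mono) auto
  also have "\<dots> = 16 * L * DPsi\<^sup>2 / real Nbar + 4 * sqrt 6 * \<sigma> / n * (DPsi\<^sup>2 / Dt)"
    using n L_pos Dt_pos by (simp add: q n(2) field_simps)
  finally have 1: "8 * L * DPsi\<^sup>2 / real N \<le> 16 * L * DPsi\<^sup>2 / real Nbar + 4 * sqrt 6 * \<sigma> / n * (DPsi\<^sup>2 / Dt)"
    by simp
  define r where "r = sqrt 6 * \<sigma> / (4 * L * Dt * n)"
  \<comment> \<open>If the cap \<open>Nbar\<close> is below \<open>q\<close>, only
    \<open>m \<ge> Nbar\<close> is available; this case produces the entry \<open>r\<close> of the
    maximum in the bound.\<close>
  have "min q (real Nbar) \<le> real m" using m_ge_min by (simp add: q_def min_def split: if_splits)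
  then have "1 / real m \<le> max (1 / q) (1 / real Nbar)"
    using qpos mN n(1) Nbar_pos by (cases "q \<le> real Nbar") (auto simp: le_max_iff_disj frac_le)
  then have "6 * \<sigma>\<^sup>2 / L * (1 / real m) \<le> 6 * \<sigma>\<^sup>2 / L * max (1 / q) (1 / real Nbar)"
    using L_pos by (intro mult_left_mono) auto
  also have "\<dots> = max (6 * \<sigma>\<^sup>2 / L * (1 / q)) (6 * \<sigma>\<^sup>2 / L * (1 / real Nbar))"
    using L_pos by (simp add: max_mult_distrib_left)
  also have "6 * \<sigma>\<^sup>2 / L * (1 / q) = 4 * sqrt 6 * \<sigma> / n * Dt"
  proof -
    have "6 * \<sigma>\<^sup>2 / L * (1 / q) = (sqrt 6 * sqrt 6) * \<sigma>\<^sup>2 / L * (1 / q)" by simp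
    also have "\<dots> = 4 * sqrt 6 * \<sigma> / n * Dt"
      using n(1) L_pos Dt_pos \<sigma>_pos unfolding q by (simp add: divide_simps power2_eq_square)
    finally show ?thesis .
  qed
  also have "6 * \<sigma>\<^sup>2 / L * (1 / real Nbar) = 4 * sqrt 6 * \<sigma> / n * (Dt * r)"
  proof -
    have "6 * \<sigma>\<^sup>2 / L * (1 / real Nbar) = (sqrt 6 * sqrt 6) * \<sigma>\<^sup>2 / L * (1 / (n * n))" by (simp add: n)
    also have "\<dots> = 4 * sqrt 6 * \<sigma> / n * (Dt * r)"
      using n(1) L_pos Dt_pos unfolding r_def by (simp add: divide_simps power2_eq_square)
    finally show ?thesis .
  qed
  also have "max (4 * sqrt 6 * \<sigma> / n * Dt) (4 * sqrt 6 * \<sigma> / n * (Dt * r)) = 4 * sqrt 6 * \<sigma> / n * (Dt * max 1 r)"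
    using n \<sigma>_pos Dt_pos by (simp add: max_mult_distrib_left)
  finally have 2: "6 * \<sigma>\<^sup>2 / (L * real m) \<le> 4 * sqrt 6 * \<sigma> / n * (Dt * max 1 r)" by simp
  have "BN = 16 * L * DPsi\<^sup>2 / real Nbar + 4 * sqrt 6 * \<sigma> / n * (DPsi\<^sup>2 / Dt)
      + 4 * sqrt 6 * \<sigma> / n * (Dt * max 1 r)"
    unfolding B_bound_def r_def n_def by (simp only: distrib_left add.assoc)
  then show ?thesis using 1 2 by linarith
qed

lemma BN_pos: "BN > 0"
proof -
  have "0 < 6 * \<sigma>\<^sup>2 / (L * real m)" using \<sigma>_pos L_pos m_pos by simp
  moreover have "0 \<le> 8 * L * DPsi\<^sup>2 / real N" using L_pos by simp
  ultimately show ?thesis using B_bound_ge by linarith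
qed

text \<open>The stepsize is constant, so all weights coincide, and they are nonzero and
  cancel.\<close>

lemma R_uniform:
  assumes "s \<in> {1..S}" "k \<in> {1..N}"
  shows "\<P>(w in M. R s w = k) = 1 / real N"
proof -
  have "\<alpha> * (\<alpha> / (2 * L)) - L * (\<alpha> / (2 * L))\<^sup>2 = kappa"
    using L_pos by (simp add: kappa_def power2_eq_square field_simps)
  then have "\<alpha> * (\<alpha> / (2 * L)) - L * (\<alpha> / (2 * L))\<^sup>2 \<noteq> 0" using kappa_pos by simp
  then show ?thesis using R_distribution[OF assms] by (simp add: rspg_weight_def)
qed

lemma exact_grad_xbar_measurable:
  "s \<in> {1..S} \<Longrightarrow> (\<lambda>w. exact_grad (xbar s w)) \<in> borel_measurable M"
  by (intro borel_measurable_exact_grad xbar_measurable)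

text \<open>For a fixed \<open>k\<close> the iterate is a measurable function of the sample vector
  alone, which is independent of \<open>R s\<close>. The random index is therefore handled value by
  value.\<close>

lemma exact_grad_event_indep_R:
  assumes s: "s \<in> {1..S}" and k: "k \<in> {1..N}"
  shows "prob {w \<in> space M. R s w = k \<and> c \<le> (norm (exact_grad (x s k w)))\<^sup>2}
    = 1 / real N * \<P>(w in M. c \<le> (norm (exact_grad (x s k w)))\<^sup>2)"
proof -
  let ?V = "vimage_algebra (space M) (samples s) (PiM calls (\<lambda>_. \<Xi>))"
  let ?A = "{w \<in> space M. R s w = k}" and ?B = "{w \<in> space M. c \<le> (norm (exact_grad (x s k w)))\<^sup>2}"
  have kN: "k \<le> N" using k by simp
  have "(\<lambda>y. exact_grad (iterate y k)) \<in> borel_measurable (PiM calls (\<lambda>_. \<Xi>))"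
    by (intro borel_measurable_exact_grad iterate_PiM_measurable kN)
  from measurable_vimage_algebra_compose[OF samples_measurable[OF s] this]
  have [measurable]: "(\<lambda>w. exact_grad (x s k w)) \<in> borel_measurable ?V"
    by (simp add: x_eq_iterate_samples[OF kN])
  have "{w \<in> space ?V. c \<le> (norm (exact_grad (x s k w)))\<^sup>2} \<in> sets ?V" by measurable
  then have B: "?B \<in> sets ?V" by simp
  have "R s -` {k} \<inter> space M \<in> sets (vimage_algebra (space M) (R s) (count_space {1..N}))"
    using k by (intro in_vimage_algebra) simp
  moreover have "R s -` {k} \<inter> space M = ?A" by auto
  ultimately have A: "?A \<in> sets (vimage_algebra (space M) (R s) (count_space {1..N}))" by simp
  have "prob (?A \<inter> ?B) = prob ?A * prob ?B"
    using indep_setD[OF R_indep_samples[OF s] A] B unfolding samples_def[abs_def] calls_def by blast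
  moreover have "?A \<inter> ?B = {w \<in> space M. R s w = k \<and> c \<le> (norm (exact_grad (x s k w)))\<^sup>2}" by auto
  ultimately show ?thesis using R_uniform[OF s k] by simp
qed

text \<open>The event is split by the value of \<open>R s\<close> and Markov's inequality is applied
  at each fixed \<open>k\<close>. The average second moment is at most
  \<open>L * BN / \<alpha>\<^sup>2\<close>, and the threshold is twice that.\<close>

lemma run_failure_prob:
  assumes s: "s \<in> {1..S}"
  shows "\<P>(w in M. 2 * L * BN / \<alpha>\<^sup>2 \<le> (norm (exact_grad (xbar s w)))\<^sup>2) \<le> 1 / 2"
proof -
  define c where "c = 2 * L * BN / \<alpha>\<^sup>2"
  have c: "c > 0" using BN_pos L_pos \<alpha>_pos by (simp add: c_def)
  define e2 where "e2 k = (\<integral>w. (norm (exact_grad (x s k w)))\<^sup>2 \<partial>M)" for k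
  let ?ev = "\<lambda>k. {w \<in> space M. R s w = k \<and> c \<le> (norm (exact_grad (x s k w)))\<^sup>2}"
  have ev [measurable]: "?ev k \<in> events" if "k \<in> {1..N}" for k
  proof -
    have [measurable]: "(\<lambda>w. exact_grad (x s k w)) \<in> borel_measurable M"
      using exact_grad_x_measurable[OF s] that by simp
    have [measurable]: "R s \<in> M \<rightarrow>\<^sub>M count_space {1..N}" by (rule R_measurable[OF s])
    have "{w \<in> space M. c \<le> (norm (exact_grad (x s k w)))\<^sup>2} \<in> events" by measurable
    moreover have "R s -` {k} \<inter> space M \<in> events"
      using that by (intro measurable_sets[OF R_measurable[OF s]]) simp
    moreover have "?ev k = (R s -` {k} \<inter> space M) \<inter> {w \<in> space M. c \<le> (norm (exact_grad (x s k w)))\<^sup>2}"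
      by auto
    ultimately show ?thesis by simp
  qed
  have "{w \<in> space M. c \<le> (norm (exact_grad (xbar s w)))\<^sup>2} = (\<Union>k\<in>{1..N}. ?ev k)"
    using R_range[OF s] by (auto simp: xbar_eq)
  then have "\<P>(w in M. c \<le> (norm (exact_grad (xbar s w)))\<^sup>2) = prob (\<Union>k\<in>{1..N}. ?ev k)" by simp
  also have "\<dots> \<le> (\<Sum>k=1..N. prob (?ev k))"
    using ev by (intro finite_measure_subadditive_finite) auto
  also have "\<dots> \<le> (\<Sum>k=1..N. 1 / real N * (e2 k / c))"
  proof (rule sum_mono)
    fix k assume k: "k \<in> {1..N}"
    have "\<P>(w in M. c \<le> (norm (exact_grad (x s k w)))\<^sup>2) \<le> e2 k / c"
      unfolding e2_def using exact_grad_sum_bound(1)[OF s k] c by (intro integral_Markov_inequality_measure[where A = "{}"]) auto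
    then show "prob (?ev k) \<le> 1 / real N * (e2 k / c)"
      unfolding exact_grad_event_indep_R[OF s k] by (intro mult_left_mono) auto
  qed
  also have "\<dots> = (\<Sum>k=1..N. e2 k) / (real N * c)"
    by (simp add: sum_divide_distrib[symmetric] sum_distrib_left[symmetric])
  also have "\<dots> \<le> 1 / 2"
  proof -
    have Npos: "real N > 0" using N_pos by simp
    have "(\<Sum>k=1..N. e2 k) \<le> (8 * L\<^sup>2 * DPsi\<^sup>2 + 6 * real N * \<sigma>\<^sup>2 / real m) / \<alpha>\<^sup>2"
      using exact_grad_sum_bound(2)[OF s] by (simp add: e2_def)
    also have "\<dots> = real N * L / \<alpha>\<^sup>2 * (8 * L * DPsi\<^sup>2 / real N + 6 * \<sigma>\<^sup>2 / (L * real m))"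
      using Npos L_pos \<alpha>_pos m_pos by (simp add: field_simps power2_eq_square)
    also have "\<dots> \<le> real N * L / \<alpha>\<^sup>2 * BN"
      using B_bound_ge L_pos by (intro mult_left_mono) auto
    also have "\<dots> = 1 / 2 * (real N * c)" by (simp add: c_def)
    finally show ?thesis using Npos c by (simp add: pos_divide_le_eq)
  qed
  finally show ?thesis by (simp add: c_def)
qed

text \<open>Failure of a run is one and the same measurable condition \<open>A\<close> on its
  stopping index and sample vector, so independence of these pairs turns the joint probability into
  a product.\<close>

lemma all_runs_failure_prob:
  "\<P>(w in M. \<forall>s\<in>{1..S}. 2 * L * BN / \<alpha>\<^sup>2 \<le> (norm (exact_grad (xbar s w)))\<^sup>2) \<le> 1 / 2 ^ S"
proof -
  define c where "c = 2 * L * BN / \<alpha>\<^sup>2"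
  let ?Q = "count_space {1..N} \<Otimes>\<^sub>M PiM calls (\<lambda>_. \<Xi>)"
  define A where "A = {a \<in> space ?Q. c \<le> (norm (exact_grad (iterate (snd a) (fst a))))\<^sup>2}"
  define Z where "Z s w = (R s w, samples s w)" for s w
  have "(\<lambda>a. exact_grad (iterate (snd a) (fst a))) \<in> borel_measurable ?Q"
  \<comment> \<open>The stopping index has countably many values, so measurability in the samples
    for each fixed index suffices.\<close>
  proof (rule measurable_pair_measure_countable1)
    fix k assume "k \<in> {1..N}"
    then show "(\<lambda>y. exact_grad (iterate (snd (k, y)) (fst (k, y)))) \<in> borel_measurable (PiM calls (\<lambda>_. \<Xi>))"
      by (auto intro: borel_measurable_exact_grad iterate_PiM_measurable)
  qed simp
  then have A: "A \<in> sets ?Q" unfolding A_def by measurable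
  have "indep_vars (\<lambda>_. ?Q) Z {1..S}"
    using runs_indep unfolding Z_def[abs_def] samples_def[abs_def] calls_def .
  then have "prob (\<Inter>s\<in>{1..S}. Z s -` A \<inter> space M) = (\<Prod>s\<in>{1..S}. prob (Z s -` A \<inter> space M))"
    using A S_pos by (intro indep_varsD) auto
  moreover have ev: "Z s -` A \<inter> space M = {w \<in> space M. c \<le> (norm (exact_grad (xbar s w)))\<^sup>2}"
    if s: "s \<in> {1..S}" for s
  proof -
    have "Z s w \<in> A \<longleftrightarrow> c \<le> (norm (exact_grad (xbar s w)))\<^sup>2" if w: "w \<in> space M" for w
    proof -
      have "R s w \<in> {1..N}" "samples s w \<in> space (PiM calls (\<lambda>_. \<Xi>))"
        using R_range[OF s w] measurable_space[OF samples_measurable[OF s] w] by auto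
      then show ?thesis
        by (simp add: A_def Z_def space_pair_measure xbar_eq x_eq_iterate_samples)
    qed
    then show ?thesis unfolding vimage_def by blast
  qed
  moreover have "(\<Inter>s\<in>{1..S}. Z s -` A \<inter> space M)
      = {w \<in> space M. \<forall>s\<in>{1..S}. c \<le> (norm (exact_grad (xbar s w)))\<^sup>2}"
    using ev S_pos by auto
  ultimately have "\<P>(w in M. \<forall>s\<in>{1..S}. c \<le> (norm (exact_grad (xbar s w)))\<^sup>2)
      = (\<Prod>s\<in>{1..S}. \<P>(w in M. c \<le> (norm (exact_grad (xbar s w)))\<^sup>2))"
    by simp
  also have "\<dots> \<le> (\<Prod>s\<in>{1..S}. 1 / 2)"
    using run_failure_prob by (intro prod_mono) (auto simp: c_def)
  also have "\<dots> = 1 / 2 ^ S" by (simp add: power_divide)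
  finally show ?thesis by (simp add: c_def)
qed

section \<open>Post-optimization estimates and the selected candidate\<close>

lemma gbar_eq: "gbar s w = step_grad (xbar s w) (sample_avg G (xbar s w) (\<lambda>k. \<zeta> s k w) T)"
  by (simp add: gbar_def post_grad_def)

lemma gbar_measurable:
  assumes "s \<in> {1..S}"
  shows "gbar s \<in> borel_measurable M"
  unfolding gbar_eq[abs_def] using assms
  by (intro borel_measurable_step_grad sample_avg_measurable xbar_measurable \<zeta>_measurable) auto

text \<open>The Lipschitz bound reduces the deviation to the averaged noise divided by
  \<open>\<alpha>\<close>, whose second moment is at most \<open>\<sigma>\<^sup>2 / T\<close> before
  the division; the threshold is \<open>lam\<close> times the resulting bound.\<close>

lemma post_deviation_prob:
  assumes s: "s \<in> {1..S}" and lam: "lam > 0"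
  shows "\<P>(w in M. lam * \<sigma>\<^sup>2 / (\<alpha>\<^sup>2 * real T) \<le> (norm (exact_grad (xbar s w) - gbar s w))\<^sup>2) \<le> 1 / lam"
proof -
  define E where "E w = sample_avg G (xbar s w) (\<lambda>k. \<zeta> s k w) T - Df (xbar s w)" for w
  note E = post_noise[OF s, folded E_def]
  have [measurable]: "E \<in> borel_measurable M" using E(1) by (simp add: E_def[abs_def])
  have pos: "lam * \<sigma>\<^sup>2 / real T > 0" using lam \<sigma>_pos T_pos by simp
  have "\<P>(w in M. lam * \<sigma>\<^sup>2 / (\<alpha>\<^sup>2 * real T) \<le> (norm (exact_grad (xbar s w) - gbar s w))\<^sup>2)
      \<le> \<P>(w in M. lam * \<sigma>\<^sup>2 / real T \<le> (norm (E w))\<^sup>2)"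
  proof (rule finite_measure_mono)
    have "lam * \<sigma>\<^sup>2 / real T \<le> (norm (E w))\<^sup>2"
      if "lam * \<sigma>\<^sup>2 / (\<alpha>\<^sup>2 * real T) \<le> (norm (exact_grad (xbar s w) - gbar s w))\<^sup>2" for w
    proof -
      have "(norm (exact_grad (xbar s w) - gbar s w))\<^sup>2 \<le> (norm (E w) / \<alpha>)\<^sup>2"
        unfolding gbar_eq E_def using exact_grad_step_grad_diff[OF xbar_in] by (intro power_mono) auto
      with that have "(lam * \<sigma>\<^sup>2 / real T) / \<alpha>\<^sup>2 \<le> (norm (E w))\<^sup>2 / \<alpha>\<^sup>2"
        by (simp add: power_divide mult.commute)
      then show ?thesis using \<alpha>_pos by (simp only: divide_le_cancel) auto
    qed
    then show "{w \<in> space M. lam * \<sigma>\<^sup>2 / (\<alpha>\<^sup>2 * real T) \<le> (norm (exact_grad (xbar s w) - gbar s w))\<^sup>2}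
      \<subseteq> {w \<in> space M. lam * \<sigma>\<^sup>2 / real T \<le> (norm (E w))\<^sup>2}" by blast
  qed measurable
  also have "\<dots> \<le> (\<integral>w. (norm (E w))\<^sup>2 \<partial>M) / (lam * \<sigma>\<^sup>2 / real T)"
    using E(2) pos unfolding E_def[symmetric] by (intro integral_Markov_inequality_measure[where A = "{}"]) auto
  also have "\<dots> \<le> (\<sigma>\<^sup>2 / real T) / (lam * \<sigma>\<^sup>2 / real T)"
    using E(3) pos unfolding E_def[symmetric] by (intro divide_right_mono) auto
  also have "\<dots> = 1 / lam" using \<sigma>_pos T_pos lam by simp
  finally show ?thesis .
qed

abbreviation "output \<equiv> two_rspg_output X h \<omega> D\<omega> \<alpha> L G \<sigma> Dt Nbar x1 \<xi> R sel"

lemma output_eq: "output w = xbar (sel w) w"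
  by (simp add: two_rspg_output_def xbar_def)

lemma exact_grad_output_measurable: "(\<lambda>w. exact_grad (output w)) \<in> borel_measurable M"
  unfolding output_eq
  by (rule measurable_compose_countable'[where f = "\<lambda>s w. exact_grad (xbar s w)" and g = sel and I = "{1..S}"])
    (use exact_grad_xbar_measurable sel_measurable in simp_all)

lemma sel_range: "w \<in> space M \<Longrightarrow> sel w \<in> {1..S}"
  using measurable_space[OF sel_measurable] by simp

text \<open>The comparison passes from the exact to the estimated gradient at the selected index,
  then by minimality to the estimate at \<open>s\<close>, then back to the exact one. Each passage
  doubles, hence the coefficients 4, 4 and 2.\<close>

lemma output_exact_grad_le:
  assumes w: "w \<in> space M" and s: "s \<in> {1..S}"
  shows "(norm (exact_grad (output w)))\<^sup>2 \<le> 4 * (norm (exact_grad (xbar s w)))\<^sup>2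
    + 4 * (norm (exact_grad (xbar s w) - gbar s w))\<^sup>2
    + 2 * (norm (exact_grad (xbar (sel w) w) - gbar (sel w) w))\<^sup>2"
proof -
  have "norm (gbar (sel w) w) \<le> norm (gbar s w)"
    unfolding sel_min[OF w] using s by (intro Min_le) auto
  then have "(norm (gbar (sel w) w))\<^sup>2 \<le> (norm (gbar s w))\<^sup>2" by (intro power_mono) auto
  also have "\<dots> \<le> 2 * (norm (exact_grad (xbar s w)))\<^sup>2 + 2 * (norm (exact_grad (xbar s w) - gbar s w))\<^sup>2"
    using norm_add_squared_le[of "exact_grad (xbar s w)" "gbar s w - exact_grad (xbar s w)"]
    by (simp add: norm_minus_commute)
  finally show ?thesis
    using norm_add_squared_le[of "gbar (sel w) w" "exact_grad (xbar (sel w) w) - gbar (sel w) w"]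
    by (simp add: output_eq)
qed

lemma output_tail_bound:
  assumes lam: "lam > 0"
  shows "\<P>(w in M. (norm (exact_grad (output w)))\<^sup>2
      \<ge> 2 / \<alpha>\<^sup>2 * (4 * L * BN + 3 * lam * \<sigma>\<^sup>2 / real T)) \<le> real S / lam + 1 / 2 ^ S"
proof -
  define c where "c = 2 * L * BN / \<alpha>\<^sup>2"
  define t where "t = lam * \<sigma>\<^sup>2 / (\<alpha>\<^sup>2 * real T)"
  define d where "d s w = (norm (exact_grad (xbar s w) - gbar s w))\<^sup>2" for s w
  let ?A = "{w \<in> space M. \<forall>s\<in>{1..S}. c \<le> (norm (exact_grad (xbar s w)))\<^sup>2}"
  let ?D = "\<lambda>s. {w \<in> space M. t \<le> d s w}"
  \<comment> \<open>The threshold is what the comparison yields from one run below \<open>c\<close>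
    and all deviations below \<open>t\<close>: 4 for the run, 4 + 2 for the two deviations.\<close>
  have "2 / \<alpha>\<^sup>2 * (4 * L * BN + 3 * lam * \<sigma>\<^sup>2 / real T) = 4 * c + 6 * t"
    using \<alpha>_pos T_pos by (simp add: c_def t_def field_simps)
  then have "{w \<in> space M. 2 / \<alpha>\<^sup>2 * (4 * L * BN + 3 * lam * \<sigma>\<^sup>2 / real T) \<le> (norm (exact_grad (output w)))\<^sup>2}
      = {w \<in> space M. 4 * c + 6 * t \<le> (norm (exact_grad (output w)))\<^sup>2}" by simp
  also have "\<dots> \<subseteq> ?A \<union> (\<Union>s\<in>{1..S}. ?D s)"
  proof (rule subsetI, rule ccontr)
    fix w
    assume w: "w \<in> {w \<in> space M. 4 * c + 6 * t \<le> (norm (exact_grad (output w)))\<^sup>2}"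
      and "w \<notin> ?A \<union> (\<Union>s\<in>{1..S}. ?D s)"
    then obtain s where s: "s \<in> {1..S}" "(norm (exact_grad (xbar s w)))\<^sup>2 < c"
      and d: "\<And>s. s \<in> {1..S} \<Longrightarrow> d s w < t" by (auto simp: not_le)
    have wM: "w \<in> space M" using w by simp
    have "(norm (exact_grad (output w)))\<^sup>2 < 4 * c + 6 * t"
      using output_exact_grad_le[OF wM s(1), folded d_def] s(2) d[OF s(1)] d[OF sel_range[OF wM]]
      by linarith
    then show False using w by simp
  qed
  finally have sub: "{w \<in> space M. 2 / \<alpha>\<^sup>2 * (4 * L * BN + 3 * lam * \<sigma>\<^sup>2 / real T) \<le> (norm (exact_grad (output w)))\<^sup>2}
      \<subseteq> ?A \<union> (\<Union>s\<in>{1..S}. ?D s)" .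
  have D: "?D s \<in> events" if "s \<in> {1..S}" for s
  proof -
    have [measurable]: "(\<lambda>w. exact_grad (xbar s w)) \<in> borel_measurable M" "gbar s \<in> borel_measurable M"
      using exact_grad_xbar_measurable gbar_measurable that by auto
    show ?thesis unfolding d_def by measurable
  qed
  have A: "?A \<in> events"
  proof -
    have "{w \<in> space M. c \<le> (norm (exact_grad (xbar s w)))\<^sup>2} \<in> events" if "s \<in> {1..S}" for s
    proof -
      have [measurable]: "(\<lambda>w. exact_grad (xbar s w)) \<in> borel_measurable M"
        using exact_grad_xbar_measurable that by auto
      show ?thesis by measurable
    qed
    then show ?thesis by (intro sets.sets_Collect_finite_All) auto
  qed
  have DU: "(\<Union>s\<in>{1..S}. ?D s) \<in> events" using D by auto
  have "\<P>(w in M. (norm (exact_grad (output w)))\<^sup>2 \<ge> 2 / \<alpha>\<^sup>2 * (4 * L * BN + 3 * lam * \<sigma>\<^sup>2 / real T))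
      \<le> prob (?A \<union> (\<Union>s\<in>{1..S}. ?D s))"
    using sub A DU by (intro finite_measure_mono) auto
  also have "\<dots> \<le> prob ?A + prob (\<Union>s\<in>{1..S}. ?D s)"
    using A DU by (rule measure_Un_le)
  also have "\<dots> \<le> 1 / 2 ^ S + (\<Sum>s=1..S. prob (?D s))"
    using all_runs_failure_prob D
    by (intro add_mono finite_measure_subadditive_finite) (auto simp: c_def)
  also have "\<dots> \<le> 1 / 2 ^ S + (\<Sum>s=1..S. 1 / lam)"
    using post_deviation_prob[OF _ lam] by (intro add_left_mono sum_mono) (simp add: t_def d_def)
  also have "\<dots> = real S / lam + 1 / 2 ^ S" by simp
  finally show ?thesis .
qed

section \<open>Oracle calls and the choice of parameters\<close>

lemma two_rspg_calls_le:
  assumes "w \<in> space M"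
  shows "two_rspg_calls m S T R w \<le> S * (Nbar + T)"
proof -
  have "rspg_calls (\<lambda>_. m) (R s w) \<le> Nbar" if "s \<in> {1..S}" for s
  proof -
    \<comment> \<open>A run stopped at index \<open>R s w\<close> draws \<open>R s w - 1\<close>
      batches: the output iterate itself is not sampled.\<close>
    have "R s w - 1 \<le> N" using R_range[OF that assms] by auto
    then have "m * (R s w - 1) \<le> m * N" by (rule mult_left_mono) simp
    then have "m * (R s w - 1) \<le> Nbar" using m_mult_N_le by (rule order_trans)
    then show ?thesis by (simp add: rspg_calls_def mult.commute)
  qed
  then have "(\<Sum>s=1..S. rspg_calls (\<lambda>_. m) (R s w)) \<le> (\<Sum>s=1..S. Nbar)" by (rule sum_mono)
  then show ?thesis by (simp add: two_rspg_calls_def distrib_left)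
qed

text \<open>The third entry of the maximum in \<open>Nbar_choice\<close> forces the inner maximum of
  \<open>BN\<close> to be 1. The first two entries then make the two parts of \<open>BN\<close>
  contribute at most \<epsilon> / 4 each, and \<open>T_choice\<close> leaves \<epsilon> / 2 to the
  post-optimization term.\<close>

lemma accuracy_threshold:
  assumes \<epsilon>: "\<epsilon> > 0" and \<Lambda>: "0 < \<Lambda>"
    and S: "S = S_choice \<Lambda>" and Nbar: "Nbar = Nbar_choice \<alpha> L \<sigma> DPsi Dt \<epsilon>" and T: "T = T_choice \<alpha> \<sigma> \<epsilon> \<Lambda>"
  shows "2 / \<alpha>\<^sup>2 * (4 * L * BN + 3 * (2 * real S / \<Lambda>) * \<sigma>\<^sup>2 / real T) \<le> \<epsilon>"
proof -
  define n where "n = sqrt (real Nbar)"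
  have n: "n > 0" "real Nbar = n\<^sup>2" using Nbar_pos by (auto simp: n_def)
  define K where "K = (Dt + DPsi\<^sup>2 / Dt) * (128 * sqrt 6 * L * \<sigma> / (\<alpha>\<^sup>2 * \<epsilon>))"
  have "Max {512 * L\<^sup>2 * DPsi\<^sup>2 / (\<alpha>\<^sup>2 * \<epsilon>), K\<^sup>2, 3 * \<sigma>\<^sup>2 / (8 * L\<^sup>2 * Dt\<^sup>2)} \<le> real Nbar"
    unfolding Nbar Nbar_choice_def K_def by (rule real_nat_ceiling_ge)
  then have N1: "512 * L\<^sup>2 * DPsi\<^sup>2 / (\<alpha>\<^sup>2 * \<epsilon>) \<le> real Nbar" and N2: "K\<^sup>2 \<le> n\<^sup>2"
    and N3: "3 * \<sigma>\<^sup>2 / (8 * L\<^sup>2 * Dt\<^sup>2) \<le> real Nbar" by (auto simp: n(2))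
  have Tge: "24 * real S * \<sigma>\<^sup>2 / (\<alpha>\<^sup>2 * \<Lambda> * \<epsilon>) \<le> real T"
    unfolding T T_choice_def S by (rule real_nat_ceiling_ge)
  have Kn: "K \<le> n" using N2 n(1) by (simp add: power2_le_iff_abs_le)
  have "(sqrt 6 * \<sigma> / (4 * L * Dt * n))\<^sup>2 = 3 * \<sigma>\<^sup>2 / (8 * L\<^sup>2 * Dt\<^sup>2) / real Nbar"
    by (simp add: power_divide power_mult_distrib n(2))
  also have "\<dots> \<le> 1" using N3 Nbar_pos by (subst pos_divide_le_eq) simp_all
  finally have "(sqrt 6 * \<sigma> / (4 * L * Dt * n))\<^sup>2 \<le> 1\<^sup>2" by simp
  then have "sqrt 6 * \<sigma> / (4 * L * Dt * n) \<le> 1" by (rule power2_le_imp_le) simp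
  then have BN: "BN = 16 * L * DPsi\<^sup>2 / real Nbar + 4 * sqrt 6 * \<sigma> / n * (DPsi\<^sup>2 / Dt + Dt)"
    unfolding B_bound_def n_def[symmetric] by (simp add: max_def)
  have a: "8 * L / \<alpha>\<^sup>2 * (16 * L * DPsi\<^sup>2 / real Nbar) \<le> \<epsilon> / 4"
  proof -
    have "8 * L / \<alpha>\<^sup>2 * (16 * L * DPsi\<^sup>2 / real Nbar)
        = \<epsilon> / 4 * (512 * L\<^sup>2 * DPsi\<^sup>2 / (\<alpha>\<^sup>2 * \<epsilon>) / real Nbar)"
      using \<epsilon> by (simp add: power2_eq_square)
    also have "\<dots> \<le> \<epsilon> / 4 * 1"
      using N1 \<epsilon> Nbar_pos by (intro mult_left_mono) (subst pos_divide_le_eq, simp_all)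
    finally show ?thesis by simp
  qed
  have b: "8 * L / \<alpha>\<^sup>2 * (4 * sqrt 6 * \<sigma> / n * (DPsi\<^sup>2 / Dt + Dt)) \<le> \<epsilon> / 4"
  proof -
    have "8 * L / \<alpha>\<^sup>2 * (4 * sqrt 6 * \<sigma> / n * (DPsi\<^sup>2 / Dt + Dt)) = \<epsilon> / 4 * (K / n)"
      using \<epsilon> \<alpha>_pos by (simp add: K_def add.commute mult.commute)
    also have "\<dots> \<le> \<epsilon> / 4 * 1" using Kn n(1) \<epsilon> by (intro mult_left_mono) auto
    finally show ?thesis by simp
  qed
  have c: "2 / \<alpha>\<^sup>2 * (3 * (2 * real S / \<Lambda>) * \<sigma>\<^sup>2 / real T) \<le> \<epsilon> / 2"
  proof -
    have "2 / \<alpha>\<^sup>2 * (3 * (2 * real S / \<Lambda>) * \<sigma>\<^sup>2 / real T)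
        = \<epsilon> / 2 * (24 * real S * \<sigma>\<^sup>2 / (\<alpha>\<^sup>2 * \<Lambda> * \<epsilon>) / real T)"
      using \<epsilon> by simp
    also have "\<dots> \<le> \<epsilon> / 2 * 1"
      using Tge \<epsilon> T_pos by (intro mult_left_mono) (subst pos_divide_le_eq, simp_all)
    finally show ?thesis by simp
  qed
  have "2 / \<alpha>\<^sup>2 * (4 * L * BN + 3 * (2 * real S / \<Lambda>) * \<sigma>\<^sup>2 / real T)
     = 8 * L / \<alpha>\<^sup>2 * (16 * L * DPsi\<^sup>2 / real Nbar) + 8 * L / \<alpha>\<^sup>2 * (4 * sqrt 6 * \<sigma> / n * (DPsi\<^sup>2 / Dt + Dt))
      + 2 / \<alpha>\<^sup>2 * (3 * (2 * real S / \<Lambda>) * \<sigma>\<^sup>2 / real T)"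
    unfolding BN by (simp add: distrib_left)
  then show ?thesis using a b c by linarith
qed

text \<open>Taking \<open>lam = 2 * S / \<Lambda>\<close> spends half of \<Lambda> on the
  post-optimization deviations; \<open>S_choice\<close> makes the probability that all runs fail at
  most the other half.\<close>

lemma output_confidence:
  assumes \<epsilon>: "\<epsilon> > 0" and \<Lambda>: "0 < \<Lambda>"
    and S: "S = S_choice \<Lambda>" and Nbar: "Nbar = Nbar_choice \<alpha> L \<sigma> DPsi Dt \<epsilon>" and T: "T = T_choice \<alpha> \<sigma> \<epsilon> \<Lambda>"
  shows "\<P>(w in M. (norm (exact_grad (output w)))\<^sup>2 \<le> \<epsilon>) \<ge> 1 - \<Lambda>"
proof -
  let ?lam = "2 * real S / \<Lambda>"
  define \<theta> where "\<theta> = 2 / \<alpha>\<^sup>2 * (4 * L * BN + 3 * ?lam * \<sigma>\<^sup>2 / real T)"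
  have \<theta>: "\<theta> \<le> \<epsilon>" unfolding \<theta>_def by (rule accuracy_threshold[OF assms])
  note [measurable] = exact_grad_output_measurable
  have "log 2 (2 / \<Lambda>) \<le> real S" unfolding S S_choice_def by (rule real_nat_ceiling_ge)
  then have "2 / \<Lambda> \<le> 2 powr real S" using \<Lambda> by (simp add: log_le_iff)
  then have two_pow: "1 / 2 ^ S \<le> \<Lambda> / 2"
    using \<Lambda> by (simp add: powr_realpow pos_divide_le_eq pos_le_divide_eq mult.commute)
  have lam: "?lam > 0" using S_pos \<Lambda> by simp
  have "1 - \<P>(w in M. (norm (exact_grad (output w)))\<^sup>2 \<le> \<epsilon>) = \<P>(w in M. \<not> (norm (exact_grad (output w)))\<^sup>2 \<le> \<epsilon>)"
    by (subst prob_neg) simp_all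
  also have "\<dots> \<le> \<P>(w in M. \<theta> \<le> (norm (exact_grad (output w)))\<^sup>2)"
    using \<theta> by (intro finite_measure_mono) auto
  also have "\<dots> \<le> real S / ?lam + 1 / 2 ^ S"
    unfolding \<theta>_def by (rule output_tail_bound[OF lam])
  also have "real S / ?lam = \<Lambda> / 2" using S_pos by simp
  finally show ?thesis using two_pow by linarith
qed

end

theorem theorem3:
  fixes X :: "'a::euclidean_space set" and M :: "'w measure" and \<Xi> :: "'b measure"
  assumes "two_rspg X f Df h L \<omega> D\<omega> \<alpha> M \<Xi> G \<sigma> Dt S Nbar T x1 \<xi> R \<zeta> sel"
  shows
    "(\<forall>lam>0.
        \<P>(w in M.
            (norm (exact_proj_grad X Df h L \<omega> D\<omega> \<alpha>
              (two_rspg_output X h \<omega> D\<omega> \<alpha> L G \<sigma> Dt Nbar x1 \<xi> R sel w)))\<^sup>2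
            \<ge> 2 / \<alpha>\<^sup>2 * (4 * L * B_bound L \<sigma> (D_Psi X f h L x1) Dt Nbar
                           + 3 * lam * \<sigma>\<^sup>2 / real T))
        \<le> real S / lam + 1 / 2 ^ S)
   \<and> (\<forall>\<epsilon> \<Lambda>.
        \<epsilon> > 0 \<and> 0 < \<Lambda> \<and> \<Lambda> < 1
        \<and> S = S_choice \<Lambda>
        \<and> Nbar = Nbar_choice \<alpha> L \<sigma> (D_Psi X f h L x1) Dt \<epsilon>
        \<and> T = T_choice \<alpha> \<sigma> \<epsilon> \<Lambda> \<longrightarrow>
        \<P>(w in M.
            (norm (exact_proj_grad X Df h L \<omega> D\<omega> \<alpha>
              (two_rspg_output X h \<omega> D\<omega> \<alpha> L G \<sigma> Dt Nbar x1 \<xi> R sel w)))\<^sup>2 \<le> \<epsilon>)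
        \<ge> 1 - \<Lambda>
        \<and> (\<forall>w\<in>space M.
             two_rspg_calls (batch_size L \<sigma> Dt Nbar) S T R w
             \<le> S_choice \<Lambda> * (Nbar_choice \<alpha> L \<sigma> (D_Psi X f h L x1) Dt \<epsilon> + T_choice \<alpha> \<sigma> \<epsilon> \<Lambda>)))"
proof (intro conjI allI impI ballI)
  fix lam :: real assume "lam > 0"
  then show "\<P>(w in M. (norm (exact_proj_grad X Df h L \<omega> D\<omega> \<alpha>
      (two_rspg_output X h \<omega> D\<omega> \<alpha> L G \<sigma> Dt Nbar x1 \<xi> R sel w)))\<^sup>2
      \<ge> 2 / \<alpha>\<^sup>2 * (4 * L * B_bound L \<sigma> (D_Psi X f h L x1) Dt Nbar + 3 * lam * \<sigma>\<^sup>2 / real T))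
    \<le> real S / lam + 1 / 2 ^ S"
    by (rule two_rspg.output_tail_bound[OF assms])
next
  fix \<epsilon> \<Lambda> :: real
  assume "\<epsilon> > 0 \<and> 0 < \<Lambda> \<and> \<Lambda> < 1 \<and> S = S_choice \<Lambda>
    \<and> Nbar = Nbar_choice \<alpha> L \<sigma> (D_Psi X f h L x1) Dt \<epsilon> \<and> T = T_choice \<alpha> \<sigma> \<epsilon> \<Lambda>"
  then have \<epsilon>\<Lambda>: "\<epsilon> > 0" "0 < \<Lambda>"
    and choice: "S = S_choice \<Lambda>" "Nbar = Nbar_choice \<alpha> L \<sigma> (D_Psi X f h L x1) Dt \<epsilon>"
      "T = T_choice \<alpha> \<sigma> \<epsilon> \<Lambda>"
    by blast+
  show "\<P>(w in M. (norm (exact_proj_grad X Df h L \<omega> D\<omega> \<alpha>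
      (two_rspg_output X h \<omega> D\<omega> \<alpha> L G \<sigma> Dt Nbar x1 \<xi> R sel w)))\<^sup>2 \<le> \<epsilon>) \<ge> 1 - \<Lambda>"
    by (rule two_rspg.output_confidence[OF assms \<epsilon>\<Lambda> choice])
  show "two_rspg_calls (batch_size L \<sigma> Dt Nbar) S T R w
      \<le> S_choice \<Lambda> * (Nbar_choice \<alpha> L \<sigma> (D_Psi X f h L x1) Dt \<epsilon> + T_choice \<alpha> \<sigma> \<epsilon> \<Lambda>)"
    if "w \<in> space M" for w
    using two_rspg.two_rspg_calls_le[OF assms that] unfolding choice[symmetric] .
qed

end
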